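(* Let $\mathfrak F_{\mathrm{def}}(G)$ be the pointed set of $A$-forms of $G$ up to $A$-definable group isomorphism, with distinguished element the class of $G$. There is a natural isomorphism of pointed sets between $\mathfrak F_{\mathrm{def}}(G)$ and $H^1_{\mathrm{def}}(\mathcal G,\mathrm{Aut}_{\mathrm{def}}(G))$. Namely, the map sending the class of an $A$-form $H$ to the cohomology class of $\Phi_{H,f}$, where $f:G\to H$ is any definable (over $M$) group isomorphism and $\Phi_{H,f}(\sigma)=f^{-1}\circ\sigma(f)$ for $\sigma\in\mathcal G$, is a (well-defined) isomorphism of pointed sets.
   Context: Setting. Fix a first-order structure $M$ and a subset $A$ of $M$ such that: (i) $M$ is atomic over $A$, i.e. for every finite tuple $a$ from $M$ the type $\mathrm{tp}(a/A)$ is isolated; (ii) for all finite tuples $a,b$ from $M$ with $\mathrm{tp}(a/A)=\mathrm{tp}(b/A)$ there is $\sigma\in\mathrm{Aut}(M/A)$ with $\sigma(a)=b$; (iii) the theory of $M$ eliminates imaginaries. Put $\mathcal G=\mathrm{Aut}(M/A)$. $G$ is an arbitrary group definable in $M$ with parameters from $A$. "Definable" means definable in $M$ with parameters from $M$; "$A$-definable" means definable with parameters from $A$. Tuples are finite. $\mathrm{Aut}_{\mathrm{def}}(G)$ is the group (under composition) of $M$-definable group automorphisms of $G$. For a definable map $f$ and $\sigma\in\mathcal G$, $\sigma(f)$ is the definable map whose graph is the image under $\sigma$ of the graph of $f$; this gives an action of $\mathcal G$ on $\mathrm{Aut}_{\mathrm{def}}(G)$ by group automorphisms. A cocycle from $\mathcal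 G$ to $\mathrm{Aut}_{\mathrm{def}}(G)$ is a map $\Phi:\mathcal G\to\mathrm{Aut}_{\mathrm{def}}(G)$ with $\Phi(\sigma_1\sigma_2)=\Phi(\sigma_1)\cdot\sigma_1(\Phi(\sigma_2))$. It is definable if there are a tuple $a$ from $M$ and an $A$-definable (partial) function $h(x,y,z)$ with $\Phi(\sigma)(-)=h(a,\sigma(a),-)$ for all $\sigma\in\mathcal G$. Cocycles $\Phi,\Psi$ are cohomologous if there is $\phi\in\mathrm{Aut}_{\mathrm{def}}(G)$ with $\Psi(\sigma)=\phi^{-1}\cdot\Phi(\sigma)\cdot\sigma(\phi)$ for all $\sigma\in\mathcal G$; this is an equivalence relation. $H^1_{\mathrm{def}}(\mathcal G,\mathrm{Aut}_{\mathrm{def}}(G))$ is the set of equivalence classes of definable cocycles, pointed by the class of the trivial cocycle. An $A$-form of $G$ is an $A$-definable group $H$ for which there is a group isomorphism $G\to H$ definable over $M$. For such an $H$ and $f:G\to H$, $\Phi_{H,f}$ is a definable cocycle. *)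

theory Defs
  imports "HOL-Algebra.Bij"
begin

section \<open>First-order logic\<close>

text \<open>
  A symbol is given together with its arity, so that a language may lack function symbols
  (or constants, or relation symbols) altogether. Formulas are built over all names;
  \<open>wf_tm\<close> and \<open>wf_fm\<close> single out those that belong to a language.
  Quantifiers use de Bruijn indices.
\<close>

record ('f, 'r) language =
  fun_symbols :: "('f \<times> nat) set"
  rel_symbols :: "('r \<times> nat) set"

datatype 'f tm = Var nat | App 'f "'f tm list"

datatype ('f, 'r) fm =
    Eq "'f tm" "'f tm"
  | Rel 'r "'f tm list"
  | Neg "('f, 'r) fm"
  | Conj "('f, 'r) fm" "('f, 'r) fm"
  | Ex "('f, 'r) fm"

fun wf_tm :: "('f, 'r) language \<Rightarrow> 'f tm \<Rightarrow> bool" where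
  "wf_tm L (Var i) \<longleftrightarrow> True"
| "wf_tm L (App f ts) \<longleftrightarrow> (f, length ts) \<in> fun_symbols L \<and> (\<forall>t \<in> set ts. wf_tm L t)"

fun wf_fm :: "('f, 'r) language \<Rightarrow> ('f, 'r) fm \<Rightarrow> bool" where
  "wf_fm L (Eq s t) \<longleftrightarrow> wf_tm L s \<and> wf_tm L t"
| "wf_fm L (Rel r ts) \<longleftrightarrow> (r, length ts) \<in> rel_symbols L \<and> (\<forall>t \<in> set ts. wf_tm L t)"
| "wf_fm L (Neg \<phi>) \<longleftrightarrow> wf_fm L \<phi>"
| "wf_fm L (Conj \<phi> \<psi>) \<longleftrightarrow> wf_fm L \<phi> \<and> wf_fm L \<psi>"
| "wf_fm L (Ex \<phi>) \<longleftrightarrow> wf_fm L \<phi>"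

fun fv_tm :: "'f tm \<Rightarrow> nat set" where
  "fv_tm (Var i) = {i}"
| "fv_tm (App f ts) = (\<Union>t \<in> set ts. fv_tm t)"

fun fv :: "('f, 'r) fm \<Rightarrow> nat set" where
  "fv (Eq s t) = fv_tm s \<union> fv_tm t"
| "fv (Rel r ts) = (\<Union>t \<in> set ts. fv_tm t)"
| "fv (Neg \<phi>) = fv \<phi>"
| "fv (Conj \<phi> \<psi>) = fv \<phi> \<union> fv \<psi>"
| "fv (Ex \<phi>) = {i. Suc i \<in> fv \<phi>}"

text \<open>The universe of a structure is the whole type \<open>'m\<close>.\<close>

record ('f, 'r, 'm) fo_structure =
  lang :: "('f, 'r) language"
  fun_interp :: "'f \<Rightarrow> 'm list \<Rightarrow> 'm"
  rel_interp :: "'r \<Rightarrow> 'm list \<Rightarrow> bool"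

fun tm_val :: "('f, 'r, 'm) fo_structure \<Rightarrow> (nat \<Rightarrow> 'm) \<Rightarrow> 'f tm \<Rightarrow> 'm" where
  "tm_val M e (Var i) = e i"
| "tm_val M e (App f ts) = fun_interp M f (map (tm_val M e) ts)"

fun holds :: "('f, 'r, 'm) fo_structure \<Rightarrow> (nat \<Rightarrow> 'm) \<Rightarrow> ('f, 'r) fm \<Rightarrow> bool" where
  "holds M e (Eq s t) \<longleftrightarrow> tm_val M e s = tm_val M e t"
| "holds M e (Rel r ts) \<longleftrightarrow> rel_interp M r (map (tm_val M e) ts)"
| "holds M e (Neg \<phi>) \<longleftrightarrow> \<not> holds M e \<phi>"
| "holds M e (Conj \<phi> \<psi>) \<longleftrightarrow> holds M e \<phi> \<and> holds M e \<psi>"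
| "holds M e (Ex \<phi>) \<longleftrightarrow> (\<exists>x. holds M (case_nat x e) \<phi>)"

definition theory_of :: "('f, 'r, 'm) fo_structure \<Rightarrow> ('f, 'r) fm set" where
  "theory_of M = {\<phi>. wf_fm (lang M) \<phi> \<and> fv \<phi> = {} \<and> (\<forall>e. holds M e \<phi>)}"

definition automorphisms_over :: "('f, 'r, 'm) fo_structure \<Rightarrow> 'm set \<Rightarrow> ('m \<Rightarrow> 'm) set" where
  "automorphisms_over M A = {\<sigma>. bij \<sigma>
     \<and> (\<forall>(f, k) \<in> fun_symbols (lang M). \<forall>xs. length xs = k \<longrightarrow>
          \<sigma> (fun_interp M f xs) = fun_interp M f (map \<sigma> xs))
     \<and> (\<forall>(r, k) \<in> rel_symbols (lang M). \<forall>xs. length xs = k \<longrightarrow>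
          (rel_interp M r xs \<longleftrightarrow> rel_interp M r (map \<sigma> xs)))
     \<and> (\<forall>a \<in> A. \<sigma> a = a)}"


section \<open>Types\<close>

text \<open>
  A formula with parameters is a pair \<open>(\<phi>, ps)\<close>. In the variables of an \<open>n\<close>-tuple, the free
  variables \<open>0, \<dots>, n - 1\<close> of \<open>\<phi>\<close> stand for the tuple and \<open>n, n + 1, \<dots>\<close> for the parameters.
\<close>

definition fm_over ::
  "('f, 'r, 'm) fo_structure \<Rightarrow> 'm set \<Rightarrow> nat \<Rightarrow> (('f, 'r) fm \<times> 'm list) set" where
  "fm_over M A n =
     {(\<phi>, ps). wf_fm (lang M) \<phi> \<and> set ps \<subseteq> A \<and> fv \<phi> \<subseteq> {..<n + length ps}}"

definition holds_at ::
  "('f, 'r, 'm) fo_structure \<Rightarrow> 'm list \<Rightarrow> ('f, 'r) fm \<times> 'm list \<Rightarrow> bool" where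
  "holds_at M xs \<theta> \<longleftrightarrow> holds M (nth (xs @ snd \<theta>)) (fst \<theta>)"

definition type_over ::
  "('f, 'r, 'm) fo_structure \<Rightarrow> 'm set \<Rightarrow> 'm list \<Rightarrow> (('f, 'r) fm \<times> 'm list) set" where
  "type_over M A a = {\<theta> \<in> fm_over M A (length a). holds_at M a \<theta>}"

definition isolated_type ::
  "('f, 'r, 'm) fo_structure \<Rightarrow> nat \<Rightarrow> (('f, 'r) fm \<times> 'm list) set \<Rightarrow> bool" where
  "isolated_type M n p \<longleftrightarrow>
     (\<exists>\<theta> \<in> p. \<forall>\<psi> \<in> p. \<forall>xs. length xs = n \<longrightarrow> holds_at M xs \<theta> \<longrightarrow> holds_at M xs \<psi>)"

definition atomic_over :: "('f, 'r, 'm) fo_structure \<Rightarrow> 'm set \<Rightarrow> bool" where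
  "atomic_over M A \<longleftrightarrow> (\<forall>a. isolated_type M (length a) (type_over M A a))"

definition homogeneous_over :: "('f, 'r, 'm) fo_structure \<Rightarrow> 'm set \<Rightarrow> bool" where
  "homogeneous_over M A \<longleftrightarrow>
     (\<forall>a b. length a = length b \<longrightarrow> type_over M A a = type_over M A b \<longrightarrow>
        (\<exists>\<sigma> \<in> automorphisms_over M A. map \<sigma> a = b))"


section \<open>Definable sets and maps, elimination of imaginaries\<close>

definition tuples :: "nat \<Rightarrow> 'm list set" where
  "tuples n = {xs. length xs = n}"

definition definable_set ::
  "('f, 'r, 'm) fo_structure \<Rightarrow> 'm set \<Rightarrow> nat \<Rightarrow> 'm list set \<Rightarrow> bool" where
  "definable_set M A n X \<longleftrightarrow> (\<exists>\<theta> \<in> fm_over M A n. X = {xs \<in> tuples n. holds_at M xs \<theta>})"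

definition graph_on :: "'m list set \<Rightarrow> ('m list \<Rightarrow> 'm list) \<Rightarrow> 'm list set" where
  "graph_on X f = {x @ f x | x. x \<in> X}"

definition definable_map ::
  "('f, 'r, 'm) fo_structure \<Rightarrow> 'm set \<Rightarrow> 'm list set \<Rightarrow> ('m list \<Rightarrow> 'm list) \<Rightarrow> bool" where
  "definable_map M A X f \<longleftrightarrow>
     (\<exists>n m. X \<subseteq> tuples n \<and> f ` X \<subseteq> tuples m \<and> definable_set M A (n + m) (graph_on X f))"

text \<open>
  Every quotient by a \<open>\<emptyset>\<close>-definable equivalence relation is \<open>\<emptyset>\<close>-definably in bijection with a
  set of tuples. (The weaker version, in which each class merely has a code and the coding formula
  may vary with the class, is equivalent for theories in which two distinct elements are
  \<open>\<emptyset>\<close>-definable, but not in general.)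
\<close>

definition eliminates_imaginaries :: "('f, 'r, 'm) fo_structure \<Rightarrow> bool" where
  "eliminates_imaginaries M \<longleftrightarrow>
     (\<forall>n E. equiv (tuples n) E \<longrightarrow> definable_set M {} (n + n) {x @ y | x y. (x, y) \<in> E} \<longrightarrow>
        (\<exists>f. definable_map M {} (tuples n) f \<and>
             (\<forall>x \<in> tuples n. \<forall>y \<in> tuples n. (x, y) \<in> E \<longleftrightarrow> f x = f y)))"

text \<open>
  The condition on a model is expressed by first-order sentences, so by completeness of
  \<open>theory_of M\<close> it holds in one model iff it holds in all of them. Hence it is no restriction
  that the models below live on the type \<open>'m\<close>.
\<close>

definition theory_eliminates_imaginaries :: "('f, 'r, 'm) fo_structure \<Rightarrow> bool" where
  "theory_eliminates_imaginaries M \<longleftrightarrow>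
     (\<forall>N :: ('f, 'r, 'm) fo_structure.
        lang N = lang M \<and> (\<forall>\<phi> \<in> theory_of M. \<forall>e. holds N e \<phi>) \<longrightarrow> eliminates_imaginaries N)"

text \<open>
  \<open>transport \<sigma> X f\<close> is \<open>\<sigma>(f)\<close> for a map \<open>f\<close> with domain \<open>X\<close>; its domain is \<open>\<sigma>(X)\<close>.
\<close>

definition transport ::
  "('m \<Rightarrow> 'm) \<Rightarrow> 'm list set \<Rightarrow> ('m list \<Rightarrow> 'm list) \<Rightarrow> 'm list \<Rightarrow> 'm list" where
  "transport \<sigma> X f = (\<lambda>x \<in> map \<sigma> ` X. map \<sigma> (f (map (inv_into UNIV \<sigma>) x)))"

lemma graph_on_transport:
  assumes "bij \<sigma>"
  shows "graph_on (map \<sigma> ` X) (transport \<sigma> X f) = map \<sigma> ` graph_on X f"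
proof -
  have inv: "map (inv_into UNIV \<sigma>) (map \<sigma> x) = x" for x
    using assms by (simp add: bij_is_inj)
  have "graph_on (map \<sigma> ` X) (transport \<sigma> X f)
      = (\<lambda>x. map \<sigma> x @ transport \<sigma> X f (map \<sigma> x)) ` X"
    unfolding graph_on_def by blast
  also have "\<dots> = (\<lambda>x. map \<sigma> (x @ f x)) ` X"
    by (rule image_cong) (simp_all only: transport_def restrict_apply' imageI inv map_append)
  also have "\<dots> = map \<sigma> ` graph_on X f"
    unfolding graph_on_def by blast
  finally show ?thesis .
qed


section \<open>Definable groups, cocycles and forms\<close>

definition definable_group ::
  "('f, 'r, 'm) fo_structure \<Rightarrow> 'm set \<Rightarrow> 'm list monoid \<Rightarrow> bool" where
  "definable_group M A G \<longleftrightarrow> group G \<and>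
     (\<exists>n. definable_set M A n (carrier G) \<and>
          definable_set M A (n + n + n)
            {x @ y @ (x \<otimes>\<^bsub>G\<^esub> y) | x y. x \<in> carrier G \<and> y \<in> carrier G})"

definition Aut_def ::
  "('f, 'r, 'm) fo_structure \<Rightarrow> 'm list monoid \<Rightarrow> ('m list \<Rightarrow> 'm list) monoid" where
  "Aut_def M G = AutoGroup G \<lparr>carrier := {f \<in> auto G. definable_map M UNIV (carrier G) f}\<rparr>"

definition cocycles ::
  "('f, 'r, 'm) fo_structure \<Rightarrow> 'm set \<Rightarrow> 'm list monoid
     \<Rightarrow> (('m \<Rightarrow> 'm) \<Rightarrow> 'm list \<Rightarrow> 'm list) set" where
  "cocycles M A G =
     {\<Phi> \<in> automorphisms_over M A \<rightarrow>\<^sub>E carrier (Aut_def M G).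
        \<forall>\<sigma>\<^sub>1 \<in> automorphisms_over M A. \<forall>\<sigma>\<^sub>2 \<in> automorphisms_over M A.
          \<Phi> (\<sigma>\<^sub>1 \<circ> \<sigma>\<^sub>2) = \<Phi> \<sigma>\<^sub>1 \<otimes>\<^bsub>Aut_def M G\<^esub> transport \<sigma>\<^sub>1 (carrier G) (\<Phi> \<sigma>\<^sub>2)}"

definition definable_partial_fun3 ::
  "('f, 'r, 'm) fo_structure \<Rightarrow> 'm set
     \<Rightarrow> ('m list \<Rightarrow> 'm list \<Rightarrow> 'm list \<Rightarrow> 'm list option) \<Rightarrow> bool" where
  "definable_partial_fun3 M A h \<longleftrightarrow>
     (\<exists>k l n m.
        (\<forall>x y z w. h x y z = Some w \<longrightarrow>
           x \<in> tuples k \<and> y \<in> tuples l \<and> z \<in> tuples n \<and> w \<in> tuples m) \<and>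
        definable_set M A (k + l + n + m) {x @ y @ z @ w | x y z w. h x y z = Some w})"

definition definable_cocycles ::
  "('f, 'r, 'm) fo_structure \<Rightarrow> 'm set \<Rightarrow> 'm list monoid
     \<Rightarrow> (('m \<Rightarrow> 'm) \<Rightarrow> 'm list \<Rightarrow> 'm list) set" where
  "definable_cocycles M A G =
     {\<Phi> \<in> cocycles M A G.
        \<exists>a h. definable_partial_fun3 M A h \<and>
          (\<forall>\<sigma> \<in> automorphisms_over M A. \<forall>z \<in> carrier G. h a (map \<sigma> a) z = Some (\<Phi> \<sigma> z))}"

definition cohomologous_rel ::
  "('f, 'r, 'm) fo_structure \<Rightarrow> 'm set \<Rightarrow> 'm list monoid
     \<Rightarrow> (('m \<Rightarrow> 'm) \<Rightarrow> 'm list \<Rightarrow> 'm list) rel" where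
  "cohomologous_rel M A G =
     {(\<Phi>, \<Psi>). \<Phi> \<in> definable_cocycles M A G \<and> \<Psi> \<in> definable_cocycles M A G \<and>
        (\<exists>\<phi> \<in> carrier (Aut_def M G). \<forall>\<sigma> \<in> automorphisms_over M A.
           \<Psi> \<sigma> = inv\<^bsub>Aut_def M G\<^esub> \<phi> \<otimes>\<^bsub>Aut_def M G\<^esub> \<Phi> \<sigma>
                  \<otimes>\<^bsub>Aut_def M G\<^esub> transport \<sigma> (carrier G) \<phi>)}"

definition trivial_cocycle ::
  "('f, 'r, 'm) fo_structure \<Rightarrow> 'm set \<Rightarrow> 'm list monoid \<Rightarrow> ('m \<Rightarrow> 'm) \<Rightarrow> 'm list \<Rightarrow> 'm list" where
  "trivial_cocycle M A G = (\<lambda>\<sigma> \<in> automorphisms_over M A. \<one>\<^bsub>Aut_def M G\<^esub>)"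

definition definable_isos ::
  "('f, 'r, 'm) fo_structure \<Rightarrow> 'm set \<Rightarrow> 'm list monoid \<Rightarrow> 'm list monoid
     \<Rightarrow> ('m list \<Rightarrow> 'm list) set" where
  "definable_isos M A G H = {f \<in> iso G H. definable_map M A (carrier G) f}"

definition A_forms ::
  "('f, 'r, 'm) fo_structure \<Rightarrow> 'm set \<Rightarrow> 'm list monoid \<Rightarrow> 'm list monoid set" where
  "A_forms M A G = {H. definable_group M A H \<and> definable_isos M UNIV G H \<noteq> {}}"

definition A_iso_rel ::
  "('f, 'r, 'm) fo_structure \<Rightarrow> 'm set \<Rightarrow> 'm list monoid \<Rightarrow> 'm list monoid rel" where
  "A_iso_rel M A G =
     {(H, K). H \<in> A_forms M A G \<and> K \<in> A_forms M A G \<and> definable_isos M A H K \<noteq> {}}"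

definition form_cocycle ::
  "('f, 'r, 'm) fo_structure \<Rightarrow> 'm set \<Rightarrow> 'm list monoid \<Rightarrow> ('m list \<Rightarrow> 'm list)
     \<Rightarrow> ('m \<Rightarrow> 'm) \<Rightarrow> 'm list \<Rightarrow> 'm list" where
  "form_cocycle M A G f =
     (\<lambda>\<sigma> \<in> automorphisms_over M A. \<lambda>x \<in> carrier G.
        inv_into (carrier G) f (transport \<sigma> (carrier G) f x))"


section \<open>Pointed sets\<close>

type_synonym 'a pointed_set = "'a set \<times> 'a"

definition pointed_iso :: "('a \<Rightarrow> 'b) \<Rightarrow> 'a pointed_set \<Rightarrow> 'b pointed_set \<Rightarrow> bool" where
  "pointed_iso F P Q \<longleftrightarrow>
     snd P \<in> fst P \<and> snd Q \<in> fst Q \<and> bij_betw F (fst P) (fst Q) \<and> F (snd P) = snd Q"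

definition Forms ::
  "('f, 'r, 'm) fo_structure \<Rightarrow> 'm set \<Rightarrow> 'm list monoid \<Rightarrow> 'm list monoid set pointed_set" where
  "Forms M A G = (A_forms M A G // A_iso_rel M A G, A_iso_rel M A G `` {G})"

definition H1 ::
  "('f, 'r, 'm) fo_structure \<Rightarrow> 'm set \<Rightarrow> 'm list monoid
     \<Rightarrow> (('m \<Rightarrow> 'm) \<Rightarrow> 'm list \<Rightarrow> 'm list) set pointed_set" where
  "H1 M A G =
     (definable_cocycles M A G // cohomologous_rel M A G,
      cohomologous_rel M A G `` {trivial_cocycle M A G})"

end

theory Submission
  imports Defs
begin

text \<open>
  The theorem is Galois descent for definable groups, with \<open>\<Gamma> = Aut(M/A)\<close> as the Galois group.

  The principle behind it is descent of definability: a set that is definable in \<open>M\<close> and invariant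
  under \<open>\<Gamma>\<close> is definable over \<open>A\<close> (\<open>definable_set_invariant\<close>). Atomicity and homogeneity give it,
  because they make the \<open>\<Gamma>\<close>-orbit of a tuple definable over \<open>A\<close> (\<open>definable_orbit\<close>), so that the
  parameters of an invariant set can be quantified away. In particular an \<open>M\<close>-definable isomorphism
  between two \<open>A\<close>-forms is \<open>A\<close>-definable as soon as it commutes with \<open>\<Gamma>\<close>.

  Well-definedness and injectivity. Let \<open>f : G \<rightarrow> H\<close> and \<open>g : G \<rightarrow> K\<close> be definable isomorphisms onto
  forms. The definable isomorphisms \<open>K \<rightarrow> H\<close> are the maps \<open>f \<circ> \<phi> \<circ> g\<inverse>\<close> with \<open>\<phi>\<close> a definable
  automorphism of \<open>G\<close>. Such a map commutes with \<open>\<Gamma>\<close> exactly if \<open>\<phi>\<close> satisfies the equation that makes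
  the cocycles of \<open>f\<close> and \<open>g\<close> cohomologous (\<open>cohomologous_iff_A_iso\<close>).

  Surjectivity. Let \<open>\<Phi>(\<sigma>) = h(a, \<sigma>(a), -)\<close> be a definable cocycle. A pair \<open>(\<sigma>(a), z)\<close> with \<open>z\<close> in \<open>G\<close>
  is read as a name for the element \<open>\<Phi>(\<sigma>)(z)\<close> of \<open>G\<close>. By the cocycle equation, applying \<open>\<rho> \<in> \<Gamma>\<close> to
  a name of \<open>w\<close> yields a name of \<open>\<Phi>(\<rho>)(\<rho>(w))\<close>; hence the relation of naming the same element is
  invariant, so \<open>A\<close>-definable, although the map from names to elements has the parameter \<open>a\<close>. Elimination of
  imaginaries provides an \<open>A\<close>-definable map \<open>q\<close> that identifies exactly the names of the same
  element (\<open>definable_section_code\<close>). The map \<open>f(z) = q(a, z)\<close> is then injective on \<open>G\<close> and satisfies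
  \<open>\<sigma>(f) = f \<circ> \<Phi>(\<sigma>)\<close>. Since \<open>\<Phi>(\<sigma>)\<close> is an automorphism, \<open>\<sigma>(f)\<close> and \<open>f\<close> have the same image and
  induce the same multiplication on it. This image is an \<open>A\<close>-form whose cocycle is \<open>\<Phi>\<close>
  (\<open>form_of_equivariant_injection\<close>, \<open>definable_cocycle_form\<close>).
\<close>

section \<open>Definable predicates\<close>

lemma tuples_iff [simp]: "xs \<in> tuples n \<longleftrightarrow> length xs = n"
  by (simp add: tuples_def)

fun rename_tm :: "(nat \<Rightarrow> nat) \<Rightarrow> 'f tm \<Rightarrow> 'f tm" where
  "rename_tm f (Var i) = Var (f i)"
| "rename_tm f (App g ts) = App g (map (rename_tm f) ts)"

fun rename_fm :: "(nat \<Rightarrow> nat) \<Rightarrow> ('f, 'r) fm \<Rightarrow> ('f, 'r) fm" where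
  "rename_fm f (Eq s t) = Eq (rename_tm f s) (rename_tm f t)"
| "rename_fm f (Rel r ts) = Rel r (map (rename_tm f) ts)"
| "rename_fm f (Neg \<phi>) = Neg (rename_fm f \<phi>)"
| "rename_fm f (Conj \<phi> \<psi>) = Conj (rename_fm f \<phi>) (rename_fm f \<psi>)"
| "rename_fm f (Ex \<phi>) = Ex (rename_fm (case_nat 0 (\<lambda>i. Suc (f i))) \<phi>)"

lemma wf_rename_tm [simp]: "wf_tm L (rename_tm f t) = wf_tm L t"
  by (induction t) auto

lemma wf_rename_fm [simp]: "wf_fm L (rename_fm f \<phi>) = wf_fm L \<phi>"
  by (induction \<phi> arbitrary: f) auto

lemma fv_rename_tm: "fv_tm (rename_tm f t) = f ` fv_tm t"
  by (induction t) auto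

lemma fv_rename_fm: "fv (rename_fm f \<phi>) = f ` fv \<phi>"
proof (induction \<phi> arbitrary: f)
  case (Ex \<phi>)
  have "Suc i \<in> case_nat 0 (\<lambda>i. Suc (f i)) ` fv \<phi> \<longleftrightarrow> i \<in> f ` {i. Suc i \<in> fv \<phi>}" for i
  proof
    assume "Suc i \<in> case_nat 0 (\<lambda>i. Suc (f i)) ` fv \<phi>"
    then obtain j where "j \<in> fv \<phi>" "Suc i = case_nat 0 (\<lambda>i. Suc (f i)) j" by blast
    then show "i \<in> f ` {i. Suc i \<in> fv \<phi>}" by (cases j) auto
  next
    assume "i \<in> f ` {i. Suc i \<in> fv \<phi>}"
    then obtain j where "Suc j \<in> fv \<phi>" "i = f j" by blast
    then show "Suc i \<in> case_nat 0 (\<lambda>i. Suc (f i)) ` fv \<phi>" by (intro image_eqI[of _ _ "Suc j"]) auto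
  qed
  then show ?case by (simp add: Ex)
qed (auto simp: fv_rename_tm)

lemma tm_val_rename: "tm_val M e (rename_tm f t) = tm_val M (\<lambda>i. e (f i)) t"
  by (induction t) (auto simp: comp_def cong: map_cong)

lemma holds_rename: "holds M e (rename_fm f \<phi>) = holds M (\<lambda>i. e (f i)) \<phi>"
proof (induction \<phi> arbitrary: f e)
  case (Ex \<phi>)
  have "(\<lambda>i. case_nat x e (case_nat 0 (\<lambda>i. Suc (f i)) i)) = case_nat x (\<lambda>i. e (f i))" for x
    by (auto split: nat.split)
  then show ?case by (simp add: Ex)
qed (simp_all add: tm_val_rename comp_def)

lemma tm_val_cong: "(\<And>i. i \<in> fv_tm t \<Longrightarrow> e i = e' i) \<Longrightarrow> tm_val M e t = tm_val M e' t"
proof (induction t)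
  case (App g ts)
  then have "map (tm_val M e) ts = map (tm_val M e') ts"
    by (intro map_cong) auto
  then show ?case by (simp del: map_eq_conv)
qed auto

lemma holds_cong: "(\<And>i. i \<in> fv \<phi> \<Longrightarrow> e i = e' i) \<Longrightarrow> holds M e \<phi> = holds M e' \<phi>"
proof (induction \<phi> arbitrary: e e')
  case (Eq s t)
  then show ?case using tm_val_cong[of s e e' M] tm_val_cong[of t e e' M] by auto
next
  case (Rel r ts)
  then have "map (tm_val M e) ts = map (tm_val M e') ts"
    by (intro map_cong tm_val_cong) auto
  then show ?case by (simp del: map_eq_conv)
next
  case (Neg \<phi>)
  have "holds M e \<phi> = holds M e' \<phi>"
    by (rule Neg.IH) (simp add: Neg.prems)
  then show ?case by simp
next
  case (Conj \<phi> \<psi>)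
  have "holds M e \<phi> = holds M e' \<phi>" by (rule Conj.IH) (simp add: Conj.prems)
  moreover have "holds M e \<psi> = holds M e' \<psi>" by (rule Conj.IH) (simp add: Conj.prems)
  ultimately show ?case by simp
next
  case (Ex \<phi>)
  have "holds M (case_nat x e) \<phi> = holds M (case_nat x e') \<phi>" for x
    by (rule Ex.IH) (auto split: nat.split intro: Ex.prems)
  then show ?case by simp
qed

lemma finite_fv_tm: "finite (fv_tm t)"
  by (induction t) auto

lemma finite_fv: "finite (fv \<phi>)"
proof (induction \<phi>)
  case (Ex \<phi>)
  then have "finite (Suc -` fv \<phi>)" by (intro finite_vimageI) auto
  then show ?case by (simp add: vimage_def)
qed (auto simp: finite_fv_tm)

text \<open>
  Definability of a set of tuples speaks of the first \<open>n\<close> variables and of a parameter list, which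
  makes closure under logical operations a matter of shifting indices. The following notion, for
  predicates on valuations of countably many variables, has no such bookkeeping: each variable of
  the formula is either one of the free variables of the predicate or a parameter in \<open>B\<close>.
  Substitution is then composition with \<open>s\<close>, and a conjunction only needs renaming apart.
\<close>

definition definable_pred ::
  "('f, 'r, 'm) fo_structure \<Rightarrow> 'm set \<Rightarrow> ((nat \<Rightarrow> 'm) \<Rightarrow> bool) \<Rightarrow> bool" where
  "definable_pred M B P \<longleftrightarrow> (\<exists>\<phi> s. wf_fm (lang M) \<phi> \<and>
     (\<forall>i \<in> fv \<phi>. \<forall>b. s i = Inr b \<longrightarrow> b \<in> B) \<and>
     (\<forall>e. P e \<longleftrightarrow> holds M (\<lambda>i. case_sum e (\<lambda>b. b) (s i)) \<phi>))"

text \<open>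
  The tuples that are substituted into a definable set. They are closed under concatenation, so that
  definability of a predicate built from memberships can be read off its shape by the rules
  \<open>definable_intros\<close> below.
\<close>

definition simple_tuple :: "'m set \<Rightarrow> ((nat \<Rightarrow> 'm) \<Rightarrow> 'm list) \<Rightarrow> bool" where
  "simple_tuple B t \<longleftrightarrow> (\<exists>vs. (\<forall>b. Inr b \<in> set vs \<longrightarrow> b \<in> B) \<and> t = (\<lambda>e. map (case_sum e (\<lambda>b. b)) vs))"

lemma simple_tuple_vars: "simple_tuple B (\<lambda>e. map (\<lambda>i. e (g i)) js)"
  unfolding simple_tuple_def by (rule exI[of _ "map (\<lambda>i. Inl (g i)) js"]) auto

lemma simple_tuple_const: "set bs \<subseteq> B \<Longrightarrow> simple_tuple B (\<lambda>e. bs)"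
  unfolding simple_tuple_def by (rule exI[of _ "map Inr bs"]) (auto simp: comp_def)

lemma simple_tuple_append:
  assumes "simple_tuple B t" and "simple_tuple B u"
  shows "simple_tuple B (\<lambda>e. t e @ u e)"
proof -
  obtain vs ws where "\<forall>b. Inr b \<in> set vs \<longrightarrow> b \<in> B" "t = (\<lambda>e. map (case_sum e (\<lambda>b. b)) vs)"
    "\<forall>b. Inr b \<in> set ws \<longrightarrow> b \<in> B" "u = (\<lambda>e. map (case_sum e (\<lambda>b. b)) ws)"
    using assms unfolding simple_tuple_def by blast
  then show ?thesis
    unfolding simple_tuple_def by (intro exI[of _ "vs @ ws"]) auto
qed

lemma definable_pred_neg:
  assumes "definable_pred M B P"
  shows "definable_pred M B (\<lambda>e. \<not> P e)"
proof -
  obtain \<phi> s where "wf_fm (lang M) \<phi>" "\<forall>i \<in> fv \<phi>. \<forall>b. s i = Inr b \<longrightarrow> b \<in> B"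
    "\<forall>e. P e \<longleftrightarrow> holds M (\<lambda>i. case_sum e (\<lambda>b. b) (s i)) \<phi>"
    using assms unfolding definable_pred_def by blast
  then show ?thesis
    unfolding definable_pred_def by (intro exI[of _ "Neg \<phi>"] exI[of _ s]) auto
qed

lemma definable_pred_conj:
  assumes "definable_pred M B P" and "definable_pred M B Q"
  shows "definable_pred M B (\<lambda>e. P e \<and> Q e)"
proof -
  obtain \<phi> s where \<phi>: "wf_fm (lang M) \<phi>" "\<forall>i \<in> fv \<phi>. \<forall>b. s i = Inr b \<longrightarrow> b \<in> B"
    "\<forall>e. P e \<longleftrightarrow> holds M (\<lambda>i. case_sum e (\<lambda>b. b) (s i)) \<phi>"
    using assms(1) unfolding definable_pred_def by blast
  obtain \<psi> t where \<psi>: "wf_fm (lang M) \<psi>" "\<forall>i \<in> fv \<psi>. \<forall>b. t i = Inr b \<longrightarrow> b \<in> B"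
    "\<forall>e. Q e \<longleftrightarrow> holds M (\<lambda>i. case_sum e (\<lambda>b. b) (t i)) \<psi>"
    using assms(2) unfolding definable_pred_def by blast
  \<comment> \<open>Even variables for the first formula, odd ones for the second.\<close>
  let ?\<chi> = "Conj (rename_fm (\<lambda>i. 2 * i) \<phi>) (rename_fm (\<lambda>i. Suc (2 * i)) \<psi>)"
  let ?r = "\<lambda>i. if even i then s (i div 2) else t (i div 2)"
  have r: "?r (2 * i) = s i" "?r (Suc (2 * i)) = t i" for i
    by auto
  have "\<forall>i \<in> fv ?\<chi>. \<forall>b. ?r i = Inr b \<longrightarrow> b \<in> B"
    using \<phi>(2) \<psi>(2) r by (auto simp: fv_rename_fm)
  moreover have "P e \<and> Q e \<longleftrightarrow> holds M (\<lambda>i. case_sum e (\<lambda>b. b) (?r i)) ?\<chi>" for e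
    by (simp only: holds.simps holds_rename r \<phi>(3) \<psi>(3))
  moreover have "wf_fm (lang M) ?\<chi>"
    using \<phi>(1) \<psi>(1) by simp
  ultimately show ?thesis
    unfolding definable_pred_def by (intro exI[of _ ?\<chi>] exI[of _ ?r]) simp
qed

lemma definable_pred_ex1:
  assumes "definable_pred M B P"
  shows "definable_pred M B (\<lambda>e. \<exists>x. P (case_nat x e))"
proof -
  obtain \<phi> s where \<phi>: "wf_fm (lang M) \<phi>" "\<forall>i \<in> fv \<phi>. \<forall>b. s i = Inr b \<longrightarrow> b \<in> B"
    "\<forall>e. P e \<longleftrightarrow> holds M (\<lambda>i. case_sum e (\<lambda>b. b) (s i)) \<phi>"
    using assms unfolding definable_pred_def by blast
  \<comment> \<open>Several variables of the formula may stand for variable \<open>0\<close> of the predicate; they are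
    merged into the one bound by the quantifier.\<close>
  let ?f = "\<lambda>i. if s i = Inl 0 then 0 else Suc i"
  let ?s = "\<lambda>i. case s i of Inl j \<Rightarrow> Inl (j - 1) | Inr b \<Rightarrow> Inr b"
  have "(\<lambda>i. case_nat x (\<lambda>i. case_sum e (\<lambda>b. b) (?s i)) (?f i))
      = (\<lambda>i. case_sum (case_nat x e) (\<lambda>b. b) (s i))" for x e
    by (auto split: sum.split nat.split)
  then have equiv: "(\<exists>x. P (case_nat x e))
      \<longleftrightarrow> holds M (\<lambda>i. case_sum e (\<lambda>b. b) (?s i)) (Ex (rename_fm ?f \<phi>))" for e
    by (simp add: \<phi>(3) holds_rename)
  have pars: "\<forall>i \<in> fv (Ex (rename_fm ?f \<phi>)). \<forall>b. ?s i = Inr b \<longrightarrow> b \<in> B"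
    using \<phi>(2) by (auto simp: fv_rename_fm split: sum.splits if_splits)
  have wf: "wf_fm (lang M) (Ex (rename_fm ?f \<phi>))"
    using \<phi>(1) by simp
  show ?thesis
    unfolding definable_pred_def by (intro exI conjI allI, rule wf, rule pars, rule equiv)
qed

text \<open>
  The quantified tuple occupies the variables \<open>0, \<dots>, m - 1\<close>; those of the context move up by \<open>m\<close>.
\<close>

lemma definable_pred_ex:
  assumes "definable_pred M B (\<lambda>e. P (\<lambda>i. e (i + m)) (map e [0..<m]))"
  shows "definable_pred M B (\<lambda>e. \<exists>u \<in> tuples m. P e u)"
  using assms
proof (induction m arbitrary: P)
  case 0
  have "(\<exists>u \<in> tuples 0. P e u) \<longleftrightarrow> P e []" for e
    by (auto simp: tuples_def)
  with 0 show ?case by simp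
next
  case (Suc m)
  let ?P = "\<lambda>e u. P (\<lambda>i. e (Suc i)) (u @ [e 0])"
  have "definable_pred M B (\<lambda>e. \<exists>u \<in> tuples m. ?P e u)"
    by (rule Suc.IH[where P = ?P]) (use Suc.prems in \<open>simp add: add.commute\<close>)
  then have "definable_pred M B (\<lambda>e. \<exists>x. \<exists>u \<in> tuples m. ?P (case_nat x e) u)"
    by (rule definable_pred_ex1[where P = "\<lambda>e. \<exists>u \<in> tuples m. ?P e u"])
  moreover have "(\<exists>x. \<exists>u \<in> tuples m. ?P (case_nat x e) u) \<longleftrightarrow> (\<exists>u \<in> tuples (Suc m). P e u)" for e
  proof
    assume "\<exists>x. \<exists>u \<in> tuples m. ?P (case_nat x e) u"
    then obtain x u where "length u = m" "P e (u @ [x])" by auto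
    then show "\<exists>u \<in> tuples (Suc m). P e u" by (intro bexI[of _ "u @ [x]"]) auto
  next
    assume "\<exists>u \<in> tuples (Suc m). P e u"
    then obtain u where "length u = Suc m" "P e u" by auto
    moreover from this(1) obtain v x where "u = v @ [x]" by (cases u rule: rev_cases) auto
    ultimately show "\<exists>x. \<exists>u \<in> tuples m. ?P (case_nat x e) u"
      by (intro exI[of _ x] bexI[of _ v]) auto
  qed
  ultimately show ?case by simp
qed

lemma definable_pred_mem:
  assumes "definable_set M B n X" and "simple_tuple B t"
  shows "definable_pred M B (\<lambda>e. t e \<in> X)"
proof -
  obtain \<phi> ps where \<phi>: "wf_fm (lang M) \<phi>" "set ps \<subseteq> B" "fv \<phi> \<subseteq> {..<n + length ps}"
    and X: "X = {xs \<in> tuples n. holds M (nth (xs @ ps)) \<phi>}"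
    using assms(1) unfolding definable_set_def fm_over_def holds_at_def by auto
  obtain vs where vs: "\<forall>b. Inr b \<in> set vs \<longrightarrow> b \<in> B" "t = (\<lambda>e. map (case_sum e (\<lambda>b. b)) vs)"
    using assms(2) unfolding simple_tuple_def by blast
  show ?thesis
  proof (cases "length vs = n")
    case True
    let ?s = "\<lambda>i. if i < n then vs ! i else Inr (ps ! (i - n))"
    have "\<forall>i \<in> fv \<phi>. \<forall>b. ?s i = Inr b \<longrightarrow> b \<in> B"
    proof (intro ballI allI impI)
      fix i b
      assume i: "i \<in> fv \<phi>" and b: "?s i = Inr b"
      show "b \<in> B"
      proof (cases "i < n")
        case True
        with b vs(1) \<open>length vs = n\<close> show ?thesis by (metis nth_mem)
      next
        case False
        with i \<phi>(3) have "i - n < length ps" by (auto dest!: subsetD)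
        with b False \<phi>(2) show ?thesis by (auto dest: nth_mem)
      qed
    qed
    moreover have "t e \<in> X \<longleftrightarrow> holds M (\<lambda>i. case_sum e (\<lambda>b. b) (?s i)) \<phi>" for e
    proof -
      have "holds M (nth (t e @ ps)) \<phi> \<longleftrightarrow> holds M (\<lambda>i. case_sum e (\<lambda>b. b) (?s i)) \<phi>"
        by (rule holds_cong) (auto simp: vs(2) nth_append True)
      then show ?thesis by (simp add: X vs(2) True)
    qed
    ultimately show ?thesis
      unfolding definable_pred_def using \<phi>(1) by (intro exI[of _ \<phi>] exI[of _ ?s]) simp
  next
    case False
    then have "t e \<notin> X" for e
      by (simp add: X vs(2))
    then show ?thesis
      unfolding definable_pred_def
      by (intro exI[of _ "Neg (Eq (Var 0) (Var 0))"] exI[of _ Inl]) auto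
  qed
qed

lemma definable_set_subset: "definable_set M B n X \<Longrightarrow> X \<subseteq> tuples n"
  unfolding definable_set_def by auto

text \<open>
  The converse of \<open>definable_pred_mem\<close>. A formula for the predicate may mention variables beyond the
  first \<open>n\<close>, on whose values the predicate does not depend. They are all replaced by one quantified
  variable; they cannot be replaced by a constant, as there may be neither parameters nor
  coordinates.
\<close>

lemma definable_set_pred:
  assumes "X \<subseteq> tuples n" and "definable_pred M B (\<lambda>e. map e [0..<n] \<in> X)"
  shows "definable_set M B n X"
proof -
  obtain \<phi> s where \<phi>: "wf_fm (lang M) \<phi>" "\<forall>i \<in> fv \<phi>. \<forall>b. s i = Inr b \<longrightarrow> b \<in> B"
    "\<And>e. map e [0..<n] \<in> X \<longleftrightarrow> holds M (\<lambda>i. case_sum e (\<lambda>b. b) (s i)) \<phi>"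
    using assms(2) unfolding definable_pred_def by blast
  have "finite (s ` fv \<phi>)" by (simp add: finite_fv)
  then have "finite (Inr -` (s ` fv \<phi>))" by (intro finite_vimageI) auto
  then obtain ps where ps: "set ps = Inr -` (s ` fv \<phi>)" by (rule finite_list[THEN exE])
  define pos where "pos b = (SOME k. k < length ps \<and> ps ! k = b)" for b
  have pos: "pos b < length ps \<and> ps ! pos b = b" if "b \<in> set ps" for b
    unfolding pos_def by (rule someI_ex) (use that in \<open>simp add: in_set_conv_nth\<close>)
  define f where "f i = (case s i of Inl j \<Rightarrow> if j < n then Suc j else 0 | Inr b \<Rightarrow> Suc (n + pos b))"
    for i
  have par: "pos b < length ps \<and> ps ! pos b = b" if "i \<in> fv \<phi>" "s i = Inr b" for i b
    using that by (intro pos) (force simp: ps)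
  have "(Ex (rename_fm f \<phi>), ps) \<in> fm_over M B n"
    using \<phi>(1,2) par ps
    by (auto simp: fm_over_def fv_rename_fm f_def split: sum.splits if_splits)
  moreover have "holds_at M xs (Ex (rename_fm f \<phi>), ps) \<longleftrightarrow> xs \<in> X" if "length xs = n" for xs
  proof -
    have "holds M (\<lambda>i. case_nat x (nth (xs @ ps)) (f i)) \<phi> \<longleftrightarrow> xs \<in> X" for x
    proof -
      let ?e = "\<lambda>j. if j < n then xs ! j else x"
      have "holds M (\<lambda>i. case_nat x (nth (xs @ ps)) (f i)) \<phi>
          \<longleftrightarrow> holds M (\<lambda>i. case_sum ?e (\<lambda>b. b) (s i)) \<phi>"
        using par that by (intro holds_cong) (auto simp: f_def nth_append split: sum.split)
      moreover have "map ?e [0..<n] = xs"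
        using that by (intro nth_equalityI) auto
      ultimately show ?thesis using \<phi>(3)[of ?e] by simp
    qed
    then show ?thesis by (simp add: holds_at_def holds_rename)
  qed
  ultimately show ?thesis
    unfolding definable_set_def using assms(1) by (intro bexI) auto
qed

lemma definable_pred_all:
  assumes "definable_pred M B (\<lambda>e. P (\<lambda>i. e (i + m)) (map e [0..<m]))"
  shows "definable_pred M B (\<lambda>e. \<forall>u \<in> tuples m. P e u)"
  using definable_pred_neg[OF definable_pred_ex[where P = "\<lambda>e u. \<not> P e u" and m = m,
        OF definable_pred_neg[OF assms]]] by simp

lemma definable_pred_iff:
  assumes "definable_pred M B P" and "definable_pred M B Q"
  shows "definable_pred M B (\<lambda>e. P e \<longleftrightarrow> Q e)"
proof -
  have "definable_pred M B (\<lambda>e. \<not> (P e \<and> \<not> Q e) \<and> \<not> (Q e \<and> \<not> P e))"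
    by (intro definable_pred_conj definable_pred_neg assms)
  then show ?thesis by (rule back_subst[of "definable_pred M B"]) auto
qed

lemmas definable_intros =
  definable_pred_conj definable_pred_iff definable_pred_ex definable_pred_all
  simple_tuple_append simple_tuple_vars simple_tuple_const

text \<open>
  For a set of concatenations of tuples of fixed lengths, the blocks of the concatenation become
  consecutive blocks of variables.
\<close>

lemma definable_blocks1:
  assumes "definable_pred M B (\<lambda>e. P (map e [0..<k]))"
  shows "definable_set M B k {x \<in> tuples k. P x}"
  by (rule definable_set_pred) (use assms in auto)

lemma definable_blocks2:
  assumes "definable_pred M B (\<lambda>e. P (map e [0..<k]) (map e [k..<k + l]))"
  shows "definable_set M B (k + l) {x @ y | x y. length x = k \<and> length y = l \<and> P x y}"
    (is "definable_set M B _ ?X")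
proof (rule definable_set_pred)
  have "map e [0..<k + l] \<in> ?X \<longleftrightarrow> P (map e [0..<k]) (map e [k..<k + l])" for e
  proof -
    have split: "map e [0..<k + l] = map e [0..<k] @ map e [k..<k + l]"
      using upt_add_eq_append[of 0 k l] by simp
    show ?thesis
    proof
      assume "map e [0..<k + l] \<in> ?X"
      then obtain x y where "map e [0..<k] @ map e [k..<k + l] = x @ y" "length x = k" "P x y"
        unfolding split by blast
      then show "P (map e [0..<k]) (map e [k..<k + l])"
        using append_eq_append_conv[of "map e [0..<k]" x "map e [k..<k + l]" y] by simp
    next
      assume "P (map e [0..<k]) (map e [k..<k + l])"
      then show "map e [0..<k + l] \<in> ?X"
        unfolding split by (intro CollectI exI conjI) (rule refl, simp_all)
    qed
  qed
  then show "definable_pred M B (\<lambda>e. map e [0..<k + l] \<in> ?X)"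
    using assms by (simp only:)
qed auto

lemma definable_blocks3:
  assumes "definable_pred M B (\<lambda>e. P (map e [0..<k]) (map e [k..<k + l]) (map e [k + l..<k + l + m]))"
  shows "definable_set M B (k + l + m)
    {x @ y @ z | x y z. length x = k \<and> length y = l \<and> length z = m \<and> P x y z}"
    (is "definable_set M B _ ?X")
proof -
  let ?Q = "\<lambda>xy. P (take k xy) (drop k xy)"
  have "[0..<k + l] = [0..<k] @ [k..<k + l]"
    using upt_add_eq_append[of 0 k l] by simp
  then have "definable_set M B (k + l + m)
      {xy @ z | xy z. length xy = k + l \<and> length z = m \<and> ?Q xy z}"
    using assms by (intro definable_blocks2) (simp add: take_map drop_map)
  also have "{xy @ z | xy z. length xy = k + l \<and> length z = m \<and> ?Q xy z} = ?X"
  proof (intro equalityI subsetI)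
    fix v assume "v \<in> {xy @ z | xy z. length xy = k + l \<and> length z = m \<and> ?Q xy z}"
    then obtain xy z where v: "v = xy @ z" "length xy = k + l" "length z = m" "?Q xy z" by blast
    then show "v \<in> ?X"
      by (intro CollectI exI[of _ "take k xy"] exI[of _ "drop k xy"] exI[of _ z])
        (simp add: append_assoc[symmetric] del: append_assoc)
  next
    fix v assume "v \<in> ?X"
    then obtain x y z where "v = x @ y @ z" "length x = k" "length y = l" "length z = m" "P x y z"
      by blast
    then show "v \<in> {xy @ z | xy z. length xy = k + l \<and> length z = m \<and> ?Q xy z}"
      by (intro CollectI exI[of _ "x @ y"] exI[of _ z]) simp
  qed
  finally show ?thesis .
qed

lemma definable_blocks4:
  assumes "definable_pred M B (\<lambda>e. P (map e [0..<k]) (map e [k..<k + l]) (map e [k + l..<k + l + m])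
    (map e [k + l + m..<k + l + m + n]))"
  shows "definable_set M B (k + l + m + n) {x @ y @ z @ w | x y z w.
    length x = k \<and> length y = l \<and> length z = m \<and> length w = n \<and> P x y z w}"
    (is "definable_set M B _ ?X")
proof -
  let ?Q = "\<lambda>xy. P (take k xy) (drop k xy)"
  let ?Y = "{xy @ z @ w | xy z w.
    length xy = k + l \<and> length z = m \<and> length w = n \<and> ?Q xy z w}"
  have "[0..<k + l] = [0..<k] @ [k..<k + l]"
    using upt_add_eq_append[of 0 k l] by simp
  then have "definable_set M B (k + l + m + n) ?Y"
    using assms by (intro definable_blocks3) (simp add: take_map drop_map)
  also have "?Y = ?X"
  proof (intro equalityI subsetI)
    fix v assume "v \<in> ?Y"
    then obtain xy z w where v: "v = xy @ z @ w" "length xy = k + l" "length z = m" "length w = n"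
      "?Q xy z w" by blast
    then show "v \<in> ?X"
      by (intro CollectI exI[of _ "take k xy"] exI[of _ "drop k xy"] exI[of _ z] exI[of _ w])
        (simp add: append_assoc[symmetric] del: append_assoc)
  next
    fix v assume "v \<in> ?X"
    then obtain x y z w where "v = x @ y @ z @ w" "length x = k" "length y = l" "length z = m"
      "length w = n" "P x y z w" by blast
    then show "v \<in> ?Y"
      by (intro CollectI exI[of _ "x @ y"] exI[of _ z] exI[of _ w]) simp
  qed
  finally show ?thesis .
qed


section \<open>Automorphisms and definability\<close>

lemma automorphism_fun:
  assumes "\<sigma> \<in> automorphisms_over M A" and "(f, length xs) \<in> fun_symbols (lang M)"
  shows "\<sigma> (fun_interp M f xs) = fun_interp M f (map \<sigma> xs)"
  using assms unfolding automorphisms_over_def by blast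

lemma automorphism_rel:
  assumes "\<sigma> \<in> automorphisms_over M A" and "(r, length xs) \<in> rel_symbols (lang M)"
  shows "rel_interp M r (map \<sigma> xs) \<longleftrightarrow> rel_interp M r xs"
  using assms unfolding automorphisms_over_def by blast

lemma automorphism_bij: "\<sigma> \<in> automorphisms_over M A \<Longrightarrow> bij \<sigma>"
  by (simp add: automorphisms_over_def)

lemma automorphism_fixes: "\<sigma> \<in> automorphisms_over M A \<Longrightarrow> set ps \<subseteq> A \<Longrightarrow> map \<sigma> ps = ps"
  by (rule map_idI) (auto simp: automorphisms_over_def)

lemma automorphismI:
  assumes "bij \<sigma>"
    and "\<And>f xs. (f, length xs) \<in> fun_symbols (lang M) \<Longrightarrow>
      \<sigma> (fun_interp M f xs) = fun_interp M f (map \<sigma> xs)"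
    and "\<And>r xs. (r, length xs) \<in> rel_symbols (lang M) \<Longrightarrow>
      rel_interp M r (map \<sigma> xs) \<longleftrightarrow> rel_interp M r xs"
    and "\<And>a. a \<in> A \<Longrightarrow> \<sigma> a = a"
  shows "\<sigma> \<in> automorphisms_over M A"
  using assms unfolding automorphisms_over_def by blast

lemma tm_val_automorphism:
  assumes "\<sigma> \<in> automorphisms_over M A"
  shows "wf_tm (lang M) t \<Longrightarrow> tm_val M (\<lambda>i. \<sigma> (e i)) t = \<sigma> (tm_val M e t)"
proof (induction t)
  case (App f ts)
  then have "map (tm_val M (\<lambda>i. \<sigma> (e i))) ts = map \<sigma> (map (tm_val M e) ts)"
    by auto
  moreover have "(f, length ts) \<in> fun_symbols (lang M)"
    using App.prems by simp
  ultimately show ?case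
    using automorphism_fun[OF assms, of f "map (tm_val M e) ts"] by (simp del: map_map)
qed simp

lemma holds_automorphism:
  assumes "\<sigma> \<in> automorphisms_over M A"
  shows "wf_fm (lang M) \<phi> \<Longrightarrow> holds M (\<lambda>i. \<sigma> (e i)) \<phi> \<longleftrightarrow> holds M e \<phi>"
proof (induction \<phi> arbitrary: e)
  case (Eq s t)
  have "inj \<sigma>" using assms by (simp add: automorphisms_over_def bij_is_inj)
  with Eq show ?case by (simp add: tm_val_automorphism[OF assms] inj_eq)
next
  case (Rel r ts)
  then have "map (tm_val M (\<lambda>i. \<sigma> (e i))) ts = map \<sigma> (map (tm_val M e) ts)"
    by (auto intro: tm_val_automorphism[OF assms])
  moreover have "(r, length ts) \<in> rel_symbols (lang M)"
    using Rel.prems by simp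
  ultimately show ?case
    using automorphism_rel[OF assms, of r "map (tm_val M e) ts"] by (simp del: map_map)
next
  case (Ex \<phi>)
  have "surj \<sigma>" using assms by (simp add: automorphisms_over_def bij_is_surj)
  have "case_nat (\<sigma> x) (\<lambda>i. \<sigma> (e i)) = (\<lambda>i. \<sigma> (case_nat x e i))" for x
    by (auto split: nat.split)
  then have "holds M (case_nat (\<sigma> x) (\<lambda>i. \<sigma> (e i))) \<phi> \<longleftrightarrow> holds M (case_nat x e) \<phi>" for x
    using Ex by simp
  then show ?case using \<open>surj \<sigma>\<close> by (metis holds.simps(5) surjD)
qed simp_all

lemma automorphism_id: "id \<in> automorphisms_over M A"
  by (rule automorphismI) simp_all

lemma automorphism_comp:
  assumes \<sigma>: "\<sigma> \<in> automorphisms_over M A" and \<tau>: "\<tau> \<in> automorphisms_over M A"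
  shows "\<sigma> \<circ> \<tau> \<in> automorphisms_over M A"
proof (rule automorphismI)
  show "bij (\<sigma> \<circ> \<tau>)"
    using assms by (intro bij_comp automorphism_bij)
  show "(\<sigma> \<circ> \<tau>) (fun_interp M f xs) = fun_interp M f (map (\<sigma> \<circ> \<tau>) xs)"
    if "(f, length xs) \<in> fun_symbols (lang M)" for f xs
    using that automorphism_fun[OF \<tau>, of f xs] automorphism_fun[OF \<sigma>, of f "map \<tau> xs"] by simp
  show "rel_interp M r (map (\<sigma> \<circ> \<tau>) xs) \<longleftrightarrow> rel_interp M r xs"
    if "(r, length xs) \<in> rel_symbols (lang M)" for r xs
    using that automorphism_rel[OF \<tau>, of r xs] automorphism_rel[OF \<sigma>, of r "map \<tau> xs"] by simp
  show "(\<sigma> \<circ> \<tau>) a = a" if "a \<in> A" for a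
    using that assms by (simp add: automorphisms_over_def)
qed

lemma map_inv_automorphism:
  assumes "\<sigma> \<in> automorphisms_over M A"
  shows "map (inv_into UNIV \<sigma>) (map \<sigma> x) = x" and "map \<sigma> (map (inv_into UNIV \<sigma>) x) = x"
  using automorphism_bij[OF assms] by (simp_all add: bij_is_inj bij_is_surj comp_def surj_f_inv_f)

lemma automorphism_inv:
  assumes \<sigma>: "\<sigma> \<in> automorphisms_over M A"
  shows "inv_into UNIV \<sigma> \<in> automorphisms_over M A" (is "?\<tau> \<in> _")
proof (rule automorphismI)
  note bij = automorphism_bij[OF \<sigma>]
  show "bij ?\<tau>"
    using bij by (rule bij_imp_bij_inv)
  show "?\<tau> (fun_interp M f xs) = fun_interp M f (map ?\<tau> xs)"
    if "(f, length xs) \<in> fun_symbols (lang M)" for f xs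
  proof -
    have "\<sigma> (fun_interp M f (map ?\<tau> xs)) = fun_interp M f xs"
      using that automorphism_fun[OF \<sigma>, of f "map ?\<tau> xs"] map_inv_automorphism(2)[OF \<sigma>, of xs]
      by (simp del: map_map)
    then show ?thesis
      using bij by (metis bij_inv_eq_iff)
  qed
  show "rel_interp M r (map ?\<tau> xs) \<longleftrightarrow> rel_interp M r xs"
    if "(r, length xs) \<in> rel_symbols (lang M)" for r xs
    using that automorphism_rel[OF \<sigma>, of r "map ?\<tau> xs"] map_inv_automorphism(2)[OF \<sigma>, of xs]
    by (simp del: map_map)
  show "?\<tau> a = a" if "a \<in> A" for a
    using that \<sigma> bij by (metis automorphism_fixes bij_inv_eq_iff empty_subsetI insert_subset
        list.inject list.map(2) list.set(1,2))
qed

lemma definable_set_automorphism: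
  assumes "definable_set M A n X" and \<sigma>: "\<sigma> \<in> automorphisms_over M A"
  shows "map \<sigma> x \<in> X \<longleftrightarrow> x \<in> X"
proof -
  obtain \<phi> ps where \<phi>: "wf_fm (lang M) \<phi>" "set ps \<subseteq> A" "fv \<phi> \<subseteq> {..<n + length ps}"
    and X: "X = {xs \<in> tuples n. holds M (nth (xs @ ps)) \<phi>}"
    using assms(1) unfolding definable_set_def fm_over_def holds_at_def by auto
  have "holds M (nth (map \<sigma> x @ ps)) \<phi> \<longleftrightarrow> holds M (nth (x @ ps)) \<phi>" if "length x = n"
  proof -
    have "map \<sigma> x @ ps = map \<sigma> (x @ ps)"
      using automorphism_fixes[OF \<sigma> \<phi>(2)] by simp
    then have "holds M (nth (map \<sigma> x @ ps)) \<phi> \<longleftrightarrow> holds M (\<lambda>i. \<sigma> ((x @ ps) ! i)) \<phi>"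
      using \<phi>(3) that by (intro holds_cong) (auto simp del: map_append)
    then show ?thesis
      using holds_automorphism[OF \<sigma> \<phi>(1)] by simp
  qed
  then show ?thesis by (auto simp: X)
qed

lemma definable_set_mono: "definable_set M B n X \<Longrightarrow> B \<subseteq> C \<Longrightarrow> definable_set M C n X"
  unfolding definable_set_def fm_over_def by fastforce

text \<open>
  Writing the parameters as further coordinates of a \<open>\<emptyset>\<close>-definable set allows them to vary.
\<close>

lemma definable_set_parameters:
  assumes "definable_set M B n X"
  obtains ps Y where "set ps \<subseteq> B" and "definable_set M {} (n + length ps) Y"
    and "\<And>x. length x = n \<Longrightarrow> x \<in> X \<longleftrightarrow> x @ ps \<in> Y"
proof -
  obtain \<phi> ps where \<phi>: "wf_fm (lang M) \<phi>" "set ps \<subseteq> B" "fv \<phi> \<subseteq> {..<n + length ps}"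
    and X: "X = {xs \<in> tuples n. holds M (nth (xs @ ps)) \<phi>}"
    using assms unfolding definable_set_def fm_over_def holds_at_def by auto
  define Y where "Y = {z \<in> tuples (n + length ps). holds_at M z (\<phi>, [])}"
  have "definable_set M {} (n + length ps) Y"
    unfolding definable_set_def Y_def using \<phi> by (intro bexI[of _ "(\<phi>, [])"]) (auto simp: fm_over_def)
  moreover have "x \<in> X \<longleftrightarrow> x @ ps \<in> Y" if "length x = n" for x
    using that by (simp add: X Y_def holds_at_def)
  ultimately show thesis using that \<phi>(2) by blast
qed

definition orbit :: "('f, 'r, 'm) fo_structure \<Rightarrow> 'm set \<Rightarrow> 'm list \<Rightarrow> 'm list set" where
  "orbit M A a = {map \<sigma> a | \<sigma>. \<sigma> \<in> automorphisms_over M A}"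

text \<open>
  An isolating formula of \<open>tp(a/A)\<close> defines the set of realizations of the type, since types are
  complete; by homogeneity these are the conjugates of \<open>a\<close>.
\<close>

lemma definable_orbit:
  assumes "atomic_over M A" and hom: "homogeneous_over M A"
  shows "definable_set M A (length a) (orbit M A a)"
proof -
  obtain \<theta> where \<theta>: "\<theta> \<in> type_over M A a"
    and isol: "\<And>\<psi> xs. \<psi> \<in> type_over M A a \<Longrightarrow> length xs = length a \<Longrightarrow> holds_at M xs \<theta> \<Longrightarrow> holds_at M xs \<psi>"
    using assms(1) unfolding atomic_over_def isolated_type_def by metis
  let ?R = "{xs \<in> tuples (length a). holds_at M xs \<theta>}"
  have def: "definable_set M A (length a) ?R"
    using \<theta> unfolding definable_set_def type_over_def by blast
  have "a \<in> ?R" using \<theta> by (simp add: type_over_def)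
  have "orbit M A a = ?R"
  proof (intro equalityI subsetI)
    fix x assume "x \<in> orbit M A a"
    then show "x \<in> ?R"
      using definable_set_automorphism[OF def] \<open>a \<in> ?R\<close> unfolding orbit_def by blast
  next
    fix x assume x: "x \<in> ?R"
    have "type_over M A x = type_over M A a"
    proof (intro equalityI subsetI)
      fix \<psi> assume "\<psi> \<in> type_over M A a"
      then show "\<psi> \<in> type_over M A x"
        using isol[of \<psi> x] x by (simp add: type_over_def)
    next
      fix \<psi> assume \<psi>: "\<psi> \<in> type_over M A x"
      let ?neg = "(Neg (fst \<psi>), snd \<psi>)"
      have neg: "?neg \<in> fm_over M A (length a)"
        using \<psi> x by (cases \<psi>) (auto simp: type_over_def fm_over_def)
      have "\<not> holds_at M x ?neg"
        using \<psi> by (simp add: type_over_def holds_at_def)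
      then have "holds_at M a \<psi>"
        using isol[of ?neg x] x neg by (auto simp: type_over_def holds_at_def)
      then show "\<psi> \<in> type_over M A a"
        using \<psi> x by (simp add: type_over_def)
    qed
    then have "\<exists>\<sigma> \<in> automorphisms_over M A. map \<sigma> a = x"
      using hom[unfolded homogeneous_over_def, rule_format, of a x] x by simp
    then show "x \<in> orbit M A a"
      unfolding orbit_def by blast
  qed
  with def show ?thesis by simp
qed

text \<open>
  An invariant set that is defined by a formula with parameters \<open>ps\<close> is also defined by the same
  formula with any conjugate in place of \<open>ps\<close>; quantifying over the orbit removes the parameters.
\<close>

lemma definable_set_invariant:
  assumes "atomic_over M A" and "homogeneous_over M A"
    and X: "definable_set M UNIV n X"
    and inv: "\<And>\<sigma> x. \<sigma> \<in> automorphisms_over M A \<Longrightarrow> x \<in> X \<Longrightarrow> map \<sigma> x \<in> X"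
  shows "definable_set M A n X"
proof -
  obtain ps Y where Y: "definable_set M {} (n + length ps) Y"
    and XY: "\<And>x. length x = n \<Longrightarrow> x \<in> X \<longleftrightarrow> x @ ps \<in> Y"
    using definable_set_parameters[OF X] by metis
  note YA = definable_set_mono[OF Y empty_subsetI]
  note orb = definable_orbit[OF assms(1,2), of ps]
  have "x \<in> X \<longleftrightarrow> (\<exists>u \<in> tuples (length ps). u \<in> orbit M A ps \<and> x @ u \<in> Y)" if x: "length x = n" for x
  proof
    assume "x \<in> X"
    moreover have "map id ps \<in> orbit M A ps"
      unfolding orbit_def using automorphism_id by blast
    ultimately show "\<exists>u \<in> tuples (length ps). u \<in> orbit M A ps \<and> x @ u \<in> Y"
      using XY[OF x] by (intro bexI[of _ ps]) auto
  next
    assume "\<exists>u \<in> tuples (length ps). u \<in> orbit M A ps \<and> x @ u \<in> Y"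
    then obtain \<sigma> where \<sigma>: "\<sigma> \<in> automorphisms_over M A" and "x @ map \<sigma> ps \<in> Y"
      unfolding orbit_def by blast
    then have "map \<sigma> (map (inv_into UNIV \<sigma>) x @ ps) \<in> Y"
      using map_inv_automorphism(2)[OF \<sigma>] by (simp del: map_map)
    then have "map (inv_into UNIV \<sigma>) x @ ps \<in> Y"
      by (rule iffD1[OF definable_set_automorphism[OF YA \<sigma>]])
    then have "map (inv_into UNIV \<sigma>) x \<in> X"
      using XY x by simp
    then show "x \<in> X"
      using inv[OF \<sigma>] map_inv_automorphism(2)[OF \<sigma>, of x] by metis
  qed
  then have "X = {x \<in> tuples n. \<exists>u \<in> tuples (length ps). u \<in> orbit M A ps \<and> x @ u \<in> Y}"
    using definable_set_subset[OF X] by auto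
  moreover have "definable_set M A n
      {x \<in> tuples n. \<exists>u \<in> tuples (length ps). u \<in> orbit M A ps \<and> x @ u \<in> Y}"
    by (intro definable_blocks1 definable_intros definable_pred_mem[OF orb] definable_pred_mem[OF YA])
  ultimately show ?thesis by simp
qed

section \<open>Definable maps\<close>

lemma graph_on_append_iff:
  "X \<subseteq> tuples n \<Longrightarrow> length x = n \<Longrightarrow> x @ u \<in> graph_on X f \<longleftrightarrow> x \<in> X \<and> u = f x"
  unfolding graph_on_def by force

lemma graph_on_subset:
  assumes "X \<subseteq> tuples n" and "f ` X \<subseteq> tuples m"
  shows "graph_on X f \<subseteq> tuples (n + m)"
proof
  fix z assume "z \<in> graph_on X f"
  then obtain x where "z = x @ f x" "x \<in> X" unfolding graph_on_def by blast
  with assms have "x \<in> tuples n" "f x \<in> tuples m" by blast+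
  with \<open>z = x @ f x\<close> show "z \<in> tuples (n + m)" by simp
qed

lemma definable_mapE:
  assumes "definable_map M B X f"
  obtains n m where "X \<subseteq> tuples n" and "f ` X \<subseteq> tuples m" and "definable_set M B (n + m) (graph_on X f)"
  using assms unfolding definable_map_def by blast

lemma definable_mapI:
  assumes "X \<subseteq> tuples n" and "f ` X \<subseteq> tuples m" and "definable_set M B (n + m) (graph_on X f)"
  shows "definable_map M B X f"
  using assms unfolding definable_map_def by blast

lemma definable_map_mono: "definable_map M B X f \<Longrightarrow> B \<subseteq> C \<Longrightarrow> definable_map M C X f"
  unfolding definable_map_def by (meson definable_set_mono)

lemma definable_map_cong:
  assumes "definable_map M B X f" and "\<And>x. x \<in> X \<Longrightarrow> f x = g x"
  shows "definable_map M B X g"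
proof -
  have "graph_on X f = graph_on X g" and "f ` X = g ` X"
    using assms(2) unfolding graph_on_def by force+
  with assms(1) show ?thesis unfolding definable_map_def by simp
qed

lemma definable_map_comp:
  assumes f: "definable_map M B X f" and g: "definable_map M B Y g" and "f ` X \<subseteq> Y"
  shows "definable_map M B X (g \<circ> f)"
proof -
  obtain n m where X: "X \<subseteq> tuples n" "f ` X \<subseteq> tuples m" and f: "definable_set M B (n + m) (graph_on X f)"
    using f by (rule definable_mapE)
  obtain m' k where Y: "Y \<subseteq> tuples m'" "g ` Y \<subseteq> tuples k" and g: "definable_set M B (m' + k) (graph_on Y g)"
    using g by (rule definable_mapE)
  let ?Z = "{x @ z | x z. length x = n \<and> length z = k \<and>
    (\<exists>u \<in> tuples m. x @ u \<in> graph_on X f \<and> u @ z \<in> graph_on Y g)}"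
  have "definable_set M B (n + k) ?Z"
    by (intro definable_blocks2 definable_intros definable_pred_mem[OF f] definable_pred_mem[OF g])
  moreover have "(\<exists>u \<in> tuples m. x @ u \<in> graph_on X f \<and> u @ z \<in> graph_on Y g)
      \<longleftrightarrow> x \<in> X \<and> z = g (f x)" if "length x = n" for x z
  proof -
    have "f x @ z \<in> graph_on Y g \<longleftrightarrow> z = g (f x)" if "x \<in> X"
    proof -
      from that \<open>f ` X \<subseteq> Y\<close> have "f x \<in> Y" by auto
      moreover from this Y(1) have "length (f x) = m'" by auto
      ultimately show ?thesis using graph_on_append_iff[OF Y(1)] by simp
    qed
    then show ?thesis
      using X(2) by (auto simp: graph_on_append_iff[OF X(1) that])
  qed
  then have "?Z = {x @ z | x z. length x = n \<and> length z = k \<and> x \<in> X \<and> z = g (f x)}"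
    by (simp cong: conj_cong)
  moreover have "length x = n \<and> length (g (f x)) = k" if "x \<in> X" for x
    using that X(1) Y(2) \<open>f ` X \<subseteq> Y\<close> by (auto simp: subset_iff)
  then have "{x @ z | x z. length x = n \<and> length z = k \<and> x \<in> X \<and> z = g (f x)}
      = graph_on X (g \<circ> f)"
    unfolding graph_on_def by (intro Collect_cong) (auto simp: comp_def)
  ultimately have "definable_set M B (n + k) (graph_on X (g \<circ> f))"
    by simp
  moreover have "(g \<circ> f) ` X \<subseteq> tuples k"
    using Y(2) \<open>f ` X \<subseteq> Y\<close> by auto
  ultimately show ?thesis
    using X(1) by (intro definable_mapI)
qed

lemma definable_map_inv_into:
  assumes "definable_map M B X f" and inj: "inj_on f X"
  shows "definable_map M B (f ` X) (inv_into X f)"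
proof -
  obtain n m where X: "X \<subseteq> tuples n" "f ` X \<subseteq> tuples m" and f: "definable_set M B (n + m) (graph_on X f)"
    using assms(1) by (rule definable_mapE)
  let ?Z = "{y @ x | y x. length y = m \<and> length x = n \<and> x @ y \<in> graph_on X f}"
  have "definable_set M B (m + n) ?Z"
    by (intro definable_blocks2 definable_intros definable_pred_mem[OF f])
  moreover have "?Z = {f x @ x | x. x \<in> X}"
  proof -
    have "?Z = {y @ x | y x. length y = m \<and> length x = n \<and> x \<in> X \<and> y = f x}"
      by (simp add: graph_on_append_iff[OF X(1)] cong: conj_cong)
    also have "\<dots> = {f x @ x | x. x \<in> X}"
      using X by (intro Collect_cong) (auto simp: subset_iff)
    finally show ?thesis .
  qed
  moreover have "{f x @ x | x. x \<in> X} = graph_on (f ` X) (inv_into X f)"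
    unfolding graph_on_def using inv_into_f_f[OF inj] by force
  moreover have "inv_into X f ` (f ` X) \<subseteq> tuples n"
    using X(1) inv_into_f_f[OF inj] by auto
  ultimately show ?thesis
    using X(2) by (intro definable_mapI[of _ m _ n]) simp_all
qed

lemma definable_map_automorphism:
  assumes "definable_map M A X f" and "\<sigma> \<in> automorphisms_over M A" and "x \<in> X"
  shows "map \<sigma> x \<in> X" and "f (map \<sigma> x) = map \<sigma> (f x)"
proof -
  obtain n m where X: "X \<subseteq> tuples n" "f ` X \<subseteq> tuples m" and f: "definable_set M A (n + m) (graph_on X f)"
    using assms(1) by (rule definable_mapE)
  have "x @ f x \<in> graph_on X f" and "length (map \<sigma> x) = n"
    using X assms(3) by (auto simp: graph_on_def)
  then have "map \<sigma> x @ map \<sigma> (f x) \<in> graph_on X f"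
    using definable_set_automorphism[OF f assms(2), of "x @ f x"] by simp
  then show "map \<sigma> x \<in> X" and "f (map \<sigma> x) = map \<sigma> (f x)"
    using graph_on_append_iff[OF X(1) \<open>length (map \<sigma> x) = n\<close>] by auto
qed

lemma definable_map_invariant:
  assumes "atomic_over M A" and "homogeneous_over M A" and "definable_map M UNIV X f"
    and inv: "\<And>\<sigma> x. \<sigma> \<in> automorphisms_over M A \<Longrightarrow> x \<in> X \<Longrightarrow> map \<sigma> x \<in> X \<and> f (map \<sigma> x) = map \<sigma> (f x)"
  shows "definable_map M A X f"
proof -
  obtain n m where X: "X \<subseteq> tuples n" "f ` X \<subseteq> tuples m" and f: "definable_set M UNIV (n + m) (graph_on X f)"
    using assms(3) by (rule definable_mapE)
  have "map \<sigma> z \<in> graph_on X f" if \<sigma>: "\<sigma> \<in> automorphisms_over M A" and z: "z \<in> graph_on X f" for \<sigma> z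
  proof -
    obtain x where "z = x @ f x" "x \<in> X"
      using z unfolding graph_on_def by blast
    then have "map \<sigma> z = map \<sigma> x @ f (map \<sigma> x)" and "map \<sigma> x \<in> X"
      using inv[OF \<sigma>] by auto
    then show ?thesis unfolding graph_on_def by blast
  qed
  then have "definable_set M A (n + m) (graph_on X f)"
    by (intro definable_set_invariant[OF assms(1,2) f])
  with X show ?thesis by (intro definable_mapI)
qed

text \<open>
  A definable map is a member \<open>f\<^sub>a\<close> of a family of maps that is definable without parameters, and
  its conjugates belong to the same family: \<open>\<sigma>(f\<^sub>a)\<close> is the member \<open>f\<^bsub>\<sigma>(a)\<^esub>\<close>.
\<close>

lemma definable_map_family:
  assumes "definable_map M UNIV X f"
  obtains n m a Y where "X \<subseteq> tuples n" and "f ` X \<subseteq> tuples m"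
    and "definable_set M {} (n + m + length a) Y"
    and "\<And>\<sigma> z. \<sigma> \<in> automorphisms_over M A \<Longrightarrow> length z = n + m \<Longrightarrow>
      z @ map \<sigma> a \<in> Y \<longleftrightarrow> z \<in> graph_on (map \<sigma> ` X) (transport \<sigma> X f)"
proof -
  obtain n m where X: "X \<subseteq> tuples n" "f ` X \<subseteq> tuples m" and f: "definable_set M UNIV (n + m) (graph_on X f)"
    using assms by (rule definable_mapE)
  obtain a Y where Y: "definable_set M {} (n + m + length a) Y"
    and XY: "\<And>z. length z = n + m \<Longrightarrow> z \<in> graph_on X f \<longleftrightarrow> z @ a \<in> Y"
    using definable_set_parameters[OF f] by metis
  have "z @ map \<sigma> a \<in> Y \<longleftrightarrow> z \<in> graph_on (map \<sigma> ` X) (transport \<sigma> X f)"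
    if \<sigma>: "\<sigma> \<in> automorphisms_over M A" and z: "length z = n + m" for \<sigma> z
  proof -
    let ?z = "map (inv_into UNIV \<sigma>) z"
    have z_eq: "map \<sigma> ?z = z"
      by (rule map_inv_automorphism(2)[OF \<sigma>])
    have "z @ map \<sigma> a = map \<sigma> (?z @ a)"
      by (simp only: map_append z_eq)
    then have "z @ map \<sigma> a \<in> Y \<longleftrightarrow> ?z @ a \<in> Y"
      using definable_set_automorphism[OF definable_set_mono[OF Y empty_subsetI] \<sigma>, of "?z @ a"]
      by (simp only:)
    also have "\<dots> \<longleftrightarrow> ?z \<in> graph_on X f"
      using XY[of ?z] z by simp
    also have "\<dots> \<longleftrightarrow> z \<in> map \<sigma> ` graph_on X f"
      using z_eq map_inv_automorphism(1)[OF \<sigma>] by (metis imageE image_eqI)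
    finally show ?thesis
      by (simp only: graph_on_transport[OF automorphism_bij[OF \<sigma>]])
  qed
  with X Y show thesis by (rule that)
qed

lemma definable_map_transport:
  assumes "definable_map M UNIV X f" and \<sigma>: "\<sigma> \<in> automorphisms_over M A"
  shows "definable_map M UNIV (map \<sigma> ` X) (transport \<sigma> X f)"
proof -
  obtain n m a Y where X: "X \<subseteq> tuples n" "f ` X \<subseteq> tuples m"
    and Y: "definable_set M {} (n + m + length a) Y"
    and XY: "\<And>\<sigma> z. \<sigma> \<in> automorphisms_over M A \<Longrightarrow> length z = n + m \<Longrightarrow>
      z @ map \<sigma> a \<in> Y \<longleftrightarrow> z \<in> graph_on (map \<sigma> ` X) (transport \<sigma> X f)"
    using definable_map_family[OF assms(1), of A] by metis
  note YU = definable_set_mono[OF Y subset_UNIV]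
  have dom: "map \<sigma> ` X \<subseteq> tuples n"
    using X(1) by auto
  have ran: "transport \<sigma> X f ` (map \<sigma> ` X) \<subseteq> tuples m"
    using X(2) by (auto simp: transport_def map_inv_automorphism(1)[OF \<sigma>] simp del: map_map)
  have "definable_set M UNIV (n + m) {z \<in> tuples (n + m). z @ map \<sigma> a \<in> Y}"
    by (intro definable_blocks1 definable_intros definable_pred_mem[OF YU] subset_UNIV)
  moreover have "graph_on (map \<sigma> ` X) (transport \<sigma> X f) \<subseteq> tuples (n + m)"
    using dom ran by (rule graph_on_subset)
  then have "{z \<in> tuples (n + m). z @ map \<sigma> a \<in> Y} = graph_on (map \<sigma> ` X) (transport \<sigma> X f)"
    using XY[OF \<sigma>] by auto
  ultimately show ?thesis
    using dom ran by (intro definable_mapI) simp_all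
qed

lemma transport_apply:
  assumes "\<sigma> \<in> automorphisms_over M A" and "x \<in> X"
  shows "transport \<sigma> X f (map \<sigma> x) = map \<sigma> (f x)"
  using assms(2) by (simp add: transport_def map_inv_automorphism(1)[OF assms(1)] del: map_map)


section \<open>Coding the sections of a relation\<close>

lemma eliminates_imaginaries_self:
  "theory_eliminates_imaginaries M \<Longrightarrow> eliminates_imaginaries M"
  unfolding theory_eliminates_imaginaries_def theory_of_def by blast

text \<open>
  Elimination of imaginaries concerns \<open>\<emptyset>\<close>-definable equivalence relations, whereas \<open>\<epsilon>\<close> has
  parameters \<open>c\<close>. It is therefore applied to pairs of a point and a parameter tuple, two pairs being
  equivalent if they determine the same section; this is an equivalence relation whatever relation
  the formula of \<open>\<epsilon>\<close> defines for other values of the parameters. The code of the section at \<open>x\<close> is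
  then that of the pair \<open>(x, c)\<close>.
\<close>

lemma definable_section_code:
  fixes M :: "('f, 'r, 'm) fo_structure"
  assumes "eliminates_imaginaries M" and \<epsilon>: "definable_set M A (n + n) \<epsilon>"
  obtains q m where "q ` tuples n \<subseteq> tuples m" and "definable_set M A (n + m) (graph_on (tuples n) q)"
    and "\<And>x y. length x = n \<Longrightarrow> length y = n \<Longrightarrow>
      q x = q y \<longleftrightarrow> (\<forall>z \<in> tuples n. x @ z \<in> \<epsilon> \<longleftrightarrow> y @ z \<in> \<epsilon>)"
proof -
  obtain c Y where c: "set c \<subseteq> A" and Y: "definable_set M {} (n + n + length c) Y"
    and \<epsilon>Y: "\<And>z. length z = n + n \<Longrightarrow> z \<in> \<epsilon> \<longleftrightarrow> z @ c \<in> Y"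
    using definable_set_parameters[OF \<epsilon>] by metis
  define k where "k = length c"
  define S where "S p = {z \<in> tuples n. take n p @ z @ drop n p \<in> Y}" for p
  define E where "E = {(p, p'). p \<in> tuples (n + k) \<and> p' \<in> tuples (n + k) \<and> S p = S p'}"
  have S: "S (x @ d) = {z \<in> tuples n. x @ z @ d \<in> Y}" if "length x = n" for x d
    using that by (simp add: S_def)
  have "equiv (tuples (n + k)) E"
    by (rule equivI) (auto simp: E_def refl_on_def sym_def trans_def)
  moreover have "{p @ p' | p p'. (p, p') \<in> E} = {x @ d @ y @ d' | x d y d'.
      length x = n \<and> length d = k \<and> length y = n \<and> length d' = k \<and>
      (\<forall>z \<in> tuples n. x @ z @ d \<in> Y \<longleftrightarrow> y @ z @ d' \<in> Y)}" (is "?L = ?R")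
  proof (intro equalityI subsetI)
    fix v assume "v \<in> ?L"
    then obtain p p' where p: "v = p @ p'" "length p = n + k" "length p' = n + k" "S p = S p'"
      by (auto simp: E_def)
    have "\<forall>z \<in> tuples n. take n p @ z @ drop n p \<in> Y \<longleftrightarrow> take n p' @ z @ drop n p' \<in> Y"
      using p(4) unfolding S_def by blast
    with p show "v \<in> ?R"
      by (intro CollectI exI[of _ "take n p"] exI[of _ "drop n p"] exI[of _ "take n p'"]
          exI[of _ "drop n p'"]) (simp flip: append_assoc)
  next
    fix v assume "v \<in> ?R"
    then obtain x d y d' where v: "v = x @ d @ y @ d'" "length x = n" "length d = k" "length y = n"
      "length d' = k" "\<forall>z \<in> tuples n. x @ z @ d \<in> Y \<longleftrightarrow> y @ z @ d' \<in> Y" by blast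
    then have "(x @ d, y @ d') \<in> E"
      by (auto simp: E_def S)
    with v(1) show "v \<in> ?L"
      by (intro CollectI exI[of _ "x @ d"] exI[of _ "y @ d'"]) simp
  qed
  moreover have "definable_set M {} (n + k + n + k) ?R"
    by (intro definable_blocks4 definable_intros definable_pred_mem[OF Y])
  ultimately obtain f where f: "definable_map M {} (tuples (n + k)) f"
    and ker: "\<And>p p'. p \<in> tuples (n + k) \<Longrightarrow> p' \<in> tuples (n + k) \<Longrightarrow> (p, p') \<in> E \<longleftrightarrow> f p = f p'"
    using assms(1)[unfolded eliminates_imaginaries_def, rule_format, of "n + k" E]
    by (auto simp: add.assoc)
  obtain n' m where "(tuples (n + k) :: 'm list set) \<subseteq> tuples n'" and ran: "f ` tuples (n + k) \<subseteq> tuples m"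
    and f: "definable_set M {} (n' + m) (graph_on (tuples (n + k)) f)"
    using f by (rule definable_mapE)
  then have "n' = n + k"
    using subsetD[of "tuples (n + k)" "tuples n'" "replicate (n + k) (undefined :: 'm)"] by simp
  let ?q = "\<lambda>x. f (x @ c)"
  let ?Z = "{x @ w | x w. length x = n \<and> length w = m \<and> x @ c @ w \<in> graph_on (tuples (n + k)) f}"
  have len: "length (?q x) = m" if "length x = n" for x
    using subsetD[OF ran, OF imageI, of "x @ c"] that by (simp add: k_def)
  then have "?q ` tuples n \<subseteq> tuples m"
    by auto
  moreover have "definable_set M A (n + m) (graph_on (tuples n) ?q)"
  proof -
    have "x @ c @ w \<in> graph_on (tuples (n + k)) f \<longleftrightarrow> w = ?q x" if "length x = n" for x w
      using graph_on_append_iff[of "tuples (n + k)" "n + k" "x @ c" w f] that by (simp add: k_def)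
    then have "?Z = {x @ w | x w. length x = n \<and> length w = m \<and> w = ?q x}"
      by (simp cong: conj_cong)
    also have "\<dots> = graph_on (tuples n) ?q"
      unfolding graph_on_def using len by (intro Collect_cong) auto
    finally have "?Z = graph_on (tuples n) ?q" .
    moreover have "definable_set M A (n + m) ?Z"
      by (intro definable_blocks2 definable_intros c
          definable_pred_mem[OF definable_set_mono[OF f empty_subsetI]])
    ultimately show ?thesis by simp
  qed
  moreover have "?q x = ?q y \<longleftrightarrow> (\<forall>z \<in> tuples n. x @ z \<in> \<epsilon> \<longleftrightarrow> y @ z \<in> \<epsilon>)"
    if x: "length x = n" and y: "length y = n" for x y
  proof -
    have "?q x = ?q y \<longleftrightarrow> S (x @ c) = S (y @ c)"
      using ker[of "x @ c" "y @ c"] x y by (simp add: k_def E_def)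
    also have "\<dots> \<longleftrightarrow> (\<forall>z \<in> tuples n. x @ z \<in> \<epsilon> \<longleftrightarrow> y @ z \<in> \<epsilon>)"
      using x y \<epsilon>Y by (auto simp: S)
    finally show ?thesis .
  qed
  ultimately show thesis by (rule that)
qed

section \<open>Definable groups and their isomorphisms\<close>

lemma definable_group_group: "definable_group M A G \<Longrightarrow> group G"
  by (simp add: definable_group_def)

lemma definable_groupE:
  assumes "definable_group M A G"
  obtains n where "definable_set M A n (carrier G)"
    and "definable_set M A (n + n + n)
      {x @ y @ (x \<otimes>\<^bsub>G\<^esub> y) | x y. x \<in> carrier G \<and> y \<in> carrier G}"
  using assms unfolding definable_group_def by blast

lemma definable_group_automorphism:
  assumes G: "definable_group M A G" and \<sigma>: "\<sigma> \<in> automorphisms_over M A" and x: "x \<in> carrier G"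
  shows "map \<sigma> x \<in> carrier G"
    and "y \<in> carrier G \<Longrightarrow> map \<sigma> (x \<otimes>\<^bsub>G\<^esub> y) = map \<sigma> x \<otimes>\<^bsub>G\<^esub> map \<sigma> y"
proof -
  obtain n where n: "definable_set M A n (carrier G)" and mult: "definable_set M A (n + n + n)
      {x @ y @ (x \<otimes>\<^bsub>G\<^esub> y) | x y. x \<in> carrier G \<and> y \<in> carrier G}" (is "definable_set M A _ ?m")
    using G by (rule definable_groupE)
  show "map \<sigma> x \<in> carrier G"
    using definable_set_automorphism[OF n \<sigma>] x by blast
  show "map \<sigma> (x \<otimes>\<^bsub>G\<^esub> y) = map \<sigma> x \<otimes>\<^bsub>G\<^esub> map \<sigma> y" if y: "y \<in> carrier G"
  proof -
    have "x @ y @ (x \<otimes>\<^bsub>G\<^esub> y) \<in> ?m" using x y by blast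
    then have "map \<sigma> x @ map \<sigma> y @ map \<sigma> (x \<otimes>\<^bsub>G\<^esub> y) \<in> ?m"
      using definable_set_automorphism[OF mult \<sigma>, of "x @ y @ (x \<otimes>\<^bsub>G\<^esub> y)"] by simp
    then obtain x' y' where *: "map \<sigma> x @ map \<sigma> y @ map \<sigma> (x \<otimes>\<^bsub>G\<^esub> y) = x' @ y' @ (x' \<otimes>\<^bsub>G\<^esub> y')"
      and xy': "x' \<in> carrier G" "y' \<in> carrier G" by blast
    have len: "length z = n" if "z \<in> carrier G" for z
      using definable_set_subset[OF n] that by auto
    have "map \<sigma> x = x'" using * len[OF x] len[OF xy'(1)] by simp
    moreover have "map \<sigma> y = y'" using * len[OF x] len[OF xy'(1)] len[OF y] len[OF xy'(2)] by simp
    ultimately show ?thesis using * by simp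
  qed
qed

lemma image_carrier:
  assumes G: "definable_group M A G" and \<sigma>: "\<sigma> \<in> automorphisms_over M A"
  shows "map \<sigma> ` carrier G = carrier G"
proof (intro equalityI subsetI)
  fix x assume "x \<in> carrier G"
  then have "map (inv_into UNIV \<sigma>) x \<in> carrier G"
    by (rule definable_group_automorphism(1)[OF G automorphism_inv[OF \<sigma>]])
  then show "x \<in> map \<sigma> ` carrier G"
    using map_inv_automorphism(2)[OF \<sigma>, of x] by (metis image_eqI)
qed (auto simp: definable_group_automorphism(1)[OF G \<sigma>])

lemma carrier_cases:
  assumes "definable_group M A G" and "\<sigma> \<in> automorphisms_over M A" and "x \<in> carrier G"
  obtains y where "y \<in> carrier G" and "x = map \<sigma> y"
  using image_carrier[OF assms(1,2)] assms(3) by blast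

lemma definable_isos_apply:
  assumes "f \<in> definable_isos M B G H"
  shows "x \<in> carrier G \<Longrightarrow> f x \<in> carrier H"
    and "x \<in> carrier G \<Longrightarrow> y \<in> carrier G \<Longrightarrow> f x = f y \<longleftrightarrow> x = y"
    and "f ` carrier G = carrier H"
    and "inj_on f (carrier G)"
proof -
  have "bij_betw f (carrier G) (carrier H)"
    using assms by (simp add: definable_isos_def iso_def)
  then show "x \<in> carrier G \<Longrightarrow> f x \<in> carrier H"
    "x \<in> carrier G \<Longrightarrow> y \<in> carrier G \<Longrightarrow> f x = f y \<longleftrightarrow> x = y"
    "f ` carrier G = carrier H" "inj_on f (carrier G)"
    by (auto simp: bij_betw_def inj_on_def)
qed

lemma definable_isos_mono: "B \<subseteq> C \<Longrightarrow> definable_isos M B G H \<subseteq> definable_isos M C G H"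
  unfolding definable_isos_def using definable_map_mono by fastforce

lemma definable_isos_comp:
  assumes "f \<in> definable_isos M B G H" and "g \<in> definable_isos M B H K"
  shows "g \<circ> f \<in> definable_isos M B G K"
  using assms iso_set_trans[of f G H g K] definable_map_comp[of M B "carrier G" f "carrier H" g]
    definable_isos_apply(3)[OF assms(1)]
  by (simp add: definable_isos_def)

lemma definable_isos_inv:
  assumes "group G" and "f \<in> definable_isos M B G H"
  shows "inv_into (carrier G) f \<in> definable_isos M B H G"
  using assms group.iso_set_sym[of G f H] definable_map_inv_into[of M B "carrier G" f]
    definable_isos_apply(3,4)[OF assms(2)]
  by (simp add: definable_isos_def)

lemma definable_isos_cong:
  assumes "group G" and "f \<in> definable_isos M B G H" and "\<And>x. x \<in> carrier G \<Longrightarrow> g x = f x"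
  shows "g \<in> definable_isos M B G H"
  using assms group.iso_eq[of G f H g] definable_map_cong[of M B "carrier G" f g]
  by (simp add: definable_isos_def)

text \<open>
  The graph of the identity consists of the \<open>x @ y\<close> with \<open>x \<cdot> 1 = y\<close>, which makes it definable from
  the parameter \<open>1\<close>; being invariant, it is definable over \<open>A\<close>.
\<close>

lemma definable_isos_id:
  assumes "atomic_over M A" and "homogeneous_over M A" and G: "definable_group M A G"
  shows "(\<lambda>x. x) \<in> definable_isos M A G G"
proof -
  interpret group G using G by (rule definable_group_group)
  obtain n where n: "definable_set M A n (carrier G)" and mult: "definable_set M A (n + n + n)
      {x @ y @ (x \<otimes>\<^bsub>G\<^esub> y) | x y. x \<in> carrier G \<and> y \<in> carrier G}" (is "definable_set M A _ ?m")
    using G by (rule definable_groupE)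
  have len: "length z = n" if "z \<in> carrier G" for z
    using definable_set_subset[OF n] that by auto
  let ?Z = "{x @ y | x y. length x = n \<and> length y = n \<and> x @ \<one>\<^bsub>G\<^esub> @ y \<in> ?m}"
  have def: "definable_set M UNIV (n + n) ?Z"
    by (intro definable_blocks2 definable_intros subset_UNIV
        definable_pred_mem[OF definable_set_mono[OF mult subset_UNIV]])
  have "x @ \<one>\<^bsub>G\<^esub> @ y \<in> ?m \<longleftrightarrow> x \<in> carrier G \<and> y = x" if "length x = n" for x y
  proof
    assume "x @ \<one>\<^bsub>G\<^esub> @ y \<in> ?m"
    then obtain x' y' where *: "x @ \<one>\<^bsub>G\<^esub> @ y = x' @ y' @ (x' \<otimes>\<^bsub>G\<^esub> y')"
      and "x' \<in> carrier G" "y' \<in> carrier G" by blast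
    then have "x = x'" and "\<one>\<^bsub>G\<^esub> = y'"
      using that len[of x'] len[of y'] len[of "\<one>\<^bsub>G\<^esub>"] by auto
    then show "x \<in> carrier G \<and> y = x"
      using * \<open>x' \<in> carrier G\<close> by (simp flip: \<open>\<one>\<^bsub>G\<^esub> = y'\<close>)
  next
    assume "x \<in> carrier G \<and> y = x"
    then show "x @ \<one>\<^bsub>G\<^esub> @ y \<in> ?m"
      by (intro CollectI exI[of _ x] exI[of _ "\<one>\<^bsub>G\<^esub>"]) simp
  qed
  then have "?Z = {x @ y | x y. length x = n \<and> length y = n \<and> x \<in> carrier G \<and> y = x}"
    by (simp cong: conj_cong)
  also have "\<dots> = graph_on (carrier G) (\<lambda>x. x)"
    unfolding graph_on_def using len by (intro Collect_cong) auto
  finally have "?Z = graph_on (carrier G) (\<lambda>x. x)" .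
  with def have "definable_map M UNIV (carrier G) (\<lambda>x. x)"
    using definable_set_subset[OF n] by (intro definable_mapI[of _ n _ n]) simp_all
  then have "definable_map M A (carrier G) (\<lambda>x. x)"
    using definable_group_automorphism(1)[OF G]
    by (intro definable_map_invariant[OF assms(1,2)]) auto
  then show ?thesis
    by (simp add: definable_isos_def iso_set_refl)
qed

lemma definable_isos_transport:
  assumes G: "definable_group M A G" and H: "definable_group M A H"
    and f: "f \<in> definable_isos M UNIV G H" and \<sigma>: "\<sigma> \<in> automorphisms_over M A"
  shows "transport \<sigma> (carrier G) f \<in> definable_isos M UNIV G H"
proof -
  let ?t = "transport \<sigma> (carrier G) f"
  interpret G: group G using G by (rule definable_group_group)
  have inj: "inj (map \<sigma>)"
    using automorphism_bij[OF \<sigma>] by (simp add: bij_is_inj)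
  have iso: "f \<in> hom G H"
    using f by (simp add: definable_isos_def iso_def)
  have "?t \<in> hom G H"
  proof (rule homI)
    fix x assume "x \<in> carrier G"
    then obtain x' where x': "x' \<in> carrier G" "x = map \<sigma> x'"
      by (rule carrier_cases[OF G \<sigma>])
    then show "?t x \<in> carrier H"
      using definable_isos_apply(1)[OF f] definable_group_automorphism(1)[OF H \<sigma>]
      by (simp add: transport_apply[OF \<sigma>])
    fix y assume "y \<in> carrier G"
    then obtain y' where y': "y' \<in> carrier G" "y = map \<sigma> y'"
      by (rule carrier_cases[OF G \<sigma>])
    have "?t (x \<otimes>\<^bsub>G\<^esub> y) = ?t (map \<sigma> (x' \<otimes>\<^bsub>G\<^esub> y'))"
      using x' y' by (simp add: definable_group_automorphism(2)[OF G \<sigma>])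
    also have "\<dots> = map \<sigma> (f x') \<otimes>\<^bsub>H\<^esub> map \<sigma> (f y')"
      using x' y' iso definable_isos_apply(1)[OF f]
      by (simp add: transport_apply[OF \<sigma>] hom_mult definable_group_automorphism(2)[OF H \<sigma>])
    finally show "?t (x \<otimes>\<^bsub>G\<^esub> y) = ?t x \<otimes>\<^bsub>H\<^esub> ?t y"
      using x' y' by (simp add: transport_apply[OF \<sigma>])
  qed
  moreover have "?t ` carrier G = carrier H"
  proof -
    have "?t ` map \<sigma> ` carrier G = map \<sigma> ` f ` carrier G"
      unfolding image_image by (intro image_cong refl) (simp add: transport_apply[OF \<sigma>])
    then show ?thesis
      by (simp only: definable_isos_apply(3)[OF f] image_carrier[OF G \<sigma>] image_carrier[OF H \<sigma>])
  qed
  moreover have "inj_on ?t (carrier G)"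
  proof (rule inj_onI)
    fix x y assume "x \<in> carrier G" "y \<in> carrier G" and eq: "?t x = ?t y"
    obtain x' where x': "x' \<in> carrier G" "x = map \<sigma> x'"
      using \<open>x \<in> carrier G\<close> by (rule carrier_cases[OF G \<sigma>])
    obtain y' where y': "y' \<in> carrier G" "y = map \<sigma> y'"
      using \<open>y \<in> carrier G\<close> by (rule carrier_cases[OF G \<sigma>])
    have "map \<sigma> (f x') = map \<sigma> (f y')"
      using eq x' y' by (simp add: transport_apply[OF \<sigma>])
    then have "f x' = f y'"
      by (rule injD[OF inj])
    then show "x = y"
      using x' y' definable_isos_apply(2)[OF f] by simp
  qed
  moreover have "definable_map M UNIV (carrier G) ?t"
    using definable_map_transport[OF _ \<sigma>, of "carrier G" f] f image_carrier[OF G \<sigma>]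
    by (simp add: definable_isos_def)
  ultimately show ?thesis
    by (simp add: definable_isos_def iso_iff)
qed


section \<open>Definable automorphisms and cocycles\<close>

lemma mem_Aut_def:
  "f \<in> carrier (Aut_def M G) \<longleftrightarrow> f \<in> extensional (carrier G) \<and> f \<in> definable_isos M UNIV G G"
  by (auto simp: Aut_def_def AutoGroup_def auto_def Bij_def definable_isos_def iso_def)

lemma mult_Aut_def:
  assumes "f \<in> carrier (Aut_def M G)" and "g \<in> carrier (Aut_def M G)"
  shows "f \<otimes>\<^bsub>Aut_def M G\<^esub> g = compose (carrier G) f g"
  using assms by (simp add: Aut_def_def AutoGroup_def BijGroup_def auto_def)

locale atomic_homogeneous_group =
  fixes M :: "('f, 'r, 'm) fo_structure" and A :: "'m set" and G :: "'m list monoid"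
  assumes atomic: "atomic_over M A"
    and homogeneous: "homogeneous_over M A"
    and G: "definable_group M A G"
begin

abbreviation \<Gamma> :: "('m \<Rightarrow> 'm) set" where
  "\<Gamma> \<equiv> automorphisms_over M A"

sublocale G: group G
  using G by (rule definable_group_group)

lemma restrict_in_Aut_def:
  assumes "f \<in> definable_isos M UNIV G G"
  shows "restrict f (carrier G) \<in> carrier (Aut_def M G)"
  using definable_isos_cong[OF G.is_group assms, of "restrict f (carrier G)"] by (simp add: mem_Aut_def)

lemma group_Aut_def: "group (Aut_def M G)"
proof -
  have "subgroup (carrier (Aut_def M G)) (BijGroup (carrier G))"
  proof (rule subgroup.intro)
    show "carrier (Aut_def M G) \<subseteq> carrier (BijGroup (carrier G))"
      by (auto simp: Aut_def_def auto_def BijGroup_def)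
    show "f \<otimes>\<^bsub>BijGroup (carrier G)\<^esub> g \<in> carrier (Aut_def M G)"
      if f: "f \<in> carrier (Aut_def M G)" and g: "g \<in> carrier (Aut_def M G)" for f g
    proof -
      have "f \<otimes>\<^bsub>BijGroup (carrier G)\<^esub> g = restrict (f \<circ> g) (carrier G)"
        using mult_Aut_def[OF f g] by (simp add: Aut_def_def AutoGroup_def compose_def comp_def)
      then show ?thesis
        using f g restrict_in_Aut_def[OF definable_isos_comp[of g M UNIV G G f G]]
        by (simp add: mem_Aut_def)
    qed
    have "(\<lambda>x. x) \<in> definable_isos M UNIV G G"
      using definable_isos_id[OF atomic homogeneous G] definable_isos_mono[of A UNIV] by blast
    then show "\<one>\<^bsub>BijGroup (carrier G)\<^esub> \<in> carrier (Aut_def M G)"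
      using restrict_in_Aut_def by (simp add: BijGroup_def)
    show "inv\<^bsub>BijGroup (carrier G)\<^esub> f \<in> carrier (Aut_def M G)" if "f \<in> carrier (Aut_def M G)" for f
    proof -
      have "f \<in> Bij (carrier G)"
        using that by (simp add: Aut_def_def auto_def)
      then show ?thesis
        using that restrict_in_Aut_def[OF definable_isos_inv[OF G.is_group]]
        by (simp add: inv_BijGroup mem_Aut_def)
    qed
  qed
  then have "group (BijGroup (carrier G) \<lparr>carrier := carrier (Aut_def M G)\<rparr>)"
    using group_BijGroup by (rule subgroup.subgroup_is_group)
  then show ?thesis
    by (simp add: Aut_def_def AutoGroup_def)
qed

lemma transport_in_Aut_def:
  assumes "f \<in> carrier (Aut_def M G)" and \<sigma>: "\<sigma> \<in> \<Gamma>"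
  shows "transport \<sigma> (carrier G) f \<in> carrier (Aut_def M G)"
  using assms definable_isos_transport[OF G G _ \<sigma>, of f] image_carrier[OF G \<sigma>]
  by (auto simp: mem_Aut_def transport_def)

text \<open>
  The two equations of nonabelian cohomology are easiest to handle pointwise, at points of the form
  \<open>\<sigma>(x)\<close>: there the conjugate \<open>\<sigma>(f)\<close> has the value \<open>\<sigma>(f(x))\<close>, and no inverse occurs.
\<close>

lemma eqI_Aut_def:
  assumes "f \<in> carrier (Aut_def M G)" and "g \<in> carrier (Aut_def M G)" and \<sigma>: "\<sigma> \<in> \<Gamma>"
  shows "f = g \<longleftrightarrow> (\<forall>x \<in> carrier G. f (map \<sigma> x) = g (map \<sigma> x))"
proof
  assume "\<forall>x \<in> carrier G. f (map \<sigma> x) = g (map \<sigma> x)"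
  then have "f y = g y" if "y \<in> carrier G" for y
    using carrier_cases[OF G \<sigma> that] by metis
  then show "f = g"
    using assms(1,2) by (auto simp: mem_Aut_def intro: extensionalityI)
qed simp

lemma mult_transport_apply:
  assumes f: "f \<in> carrier (Aut_def M G)" and g: "g \<in> carrier (Aut_def M G)" and \<sigma>: "\<sigma> \<in> \<Gamma>"
    and x: "x \<in> carrier G"
  shows "(f \<otimes>\<^bsub>Aut_def M G\<^esub> transport \<sigma> (carrier G) g) (map \<sigma> x) = f (map \<sigma> (g x))"
  using mult_Aut_def[OF f transport_in_Aut_def[OF g \<sigma>]] x definable_group_automorphism(1)[OF G \<sigma> x]
  by (simp add: compose_def transport_apply[OF \<sigma>])

lemma mem_cocycles:
  "\<Phi> \<in> cocycles M A G \<longleftrightarrow> \<Phi> \<in> \<Gamma> \<rightarrow>\<^sub>E carrier (Aut_def M G) \<and>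
    (\<forall>\<sigma> \<in> \<Gamma>. \<forall>\<tau> \<in> \<Gamma>. \<forall>x \<in> carrier G. \<Phi> (\<sigma> \<circ> \<tau>) (map \<sigma> x) = \<Phi> \<sigma> (map \<sigma> (\<Phi> \<tau> x)))"
proof -
  interpret Aut: group "Aut_def M G" by (rule group_Aut_def)
  have "\<Phi> (\<sigma> \<circ> \<tau>) = \<Phi> \<sigma> \<otimes>\<^bsub>Aut_def M G\<^esub> transport \<sigma> (carrier G) (\<Phi> \<tau>)
      \<longleftrightarrow> (\<forall>x \<in> carrier G. \<Phi> (\<sigma> \<circ> \<tau>) (map \<sigma> x) = \<Phi> \<sigma> (map \<sigma> (\<Phi> \<tau> x)))"
    if \<Phi>: "\<Phi> \<in> \<Gamma> \<rightarrow>\<^sub>E carrier (Aut_def M G)" and \<sigma>: "\<sigma> \<in> \<Gamma>" and \<tau>: "\<tau> \<in> \<Gamma>" for \<sigma> \<tau>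
  proof -
    have mem: "\<Phi> \<sigma> \<in> carrier (Aut_def M G)" "\<Phi> \<tau> \<in> carrier (Aut_def M G)"
      "\<Phi> (\<sigma> \<circ> \<tau>) \<in> carrier (Aut_def M G)"
      using \<Phi> \<sigma> \<tau> automorphism_comp[OF \<sigma> \<tau>] by auto
    show ?thesis
      using eqI_Aut_def[OF mem(3) Aut.m_closed[OF mem(1) transport_in_Aut_def[OF mem(2) \<sigma>]] \<sigma>]
      by (simp add: mult_transport_apply[OF mem(1,2) \<sigma>])
  qed
  then show ?thesis
    unfolding cocycles_def by blast
qed

lemma cocycle_mem:
  assumes "\<Phi> \<in> cocycles M A G" and "\<sigma> \<in> \<Gamma>"
  shows "\<Phi> \<sigma> \<in> definable_isos M UNIV G G" and "\<Phi> \<sigma> \<in> extensional (carrier G)"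
  using assms unfolding mem_cocycles by (auto simp: mem_Aut_def dest: PiE_mem)

lemma mem_cohomologous_rel:
  "(\<Phi>, \<Psi>) \<in> cohomologous_rel M A G \<longleftrightarrow>
    \<Phi> \<in> definable_cocycles M A G \<and> \<Psi> \<in> definable_cocycles M A G \<and>
    (\<exists>\<phi> \<in> carrier (Aut_def M G). \<forall>\<sigma> \<in> \<Gamma>. \<forall>x \<in> carrier G.
       \<phi> (\<Psi> \<sigma> (map \<sigma> x)) = \<Phi> \<sigma> (map \<sigma> (\<phi> x)))"
proof -
  interpret Aut: group "Aut_def M G" by (rule group_Aut_def)
  have "\<Psi> \<sigma> = inv\<^bsub>Aut_def M G\<^esub> \<phi> \<otimes>\<^bsub>Aut_def M G\<^esub> \<Phi> \<sigma> \<otimes>\<^bsub>Aut_def M G\<^esub> transport \<sigma> (carrier G) \<phi>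
      \<longleftrightarrow> (\<forall>x \<in> carrier G. \<phi> (\<Psi> \<sigma> (map \<sigma> x)) = \<Phi> \<sigma> (map \<sigma> (\<phi> x)))"
    if "\<Phi> \<in> definable_cocycles M A G" "\<Psi> \<in> definable_cocycles M A G"
      and \<phi>: "\<phi> \<in> carrier (Aut_def M G)" and \<sigma>: "\<sigma> \<in> \<Gamma>" for \<phi> \<sigma>
  proof -
    have \<Phi>: "\<Phi> \<sigma> \<in> carrier (Aut_def M G)" and \<Psi>: "\<Psi> \<sigma> \<in> carrier (Aut_def M G)"
      using that by (auto simp: definable_cocycles_def mem_cocycles)
    note t = transport_in_Aut_def[OF \<phi> \<sigma>]
    have "\<Psi> \<sigma> = inv\<^bsub>Aut_def M G\<^esub> \<phi> \<otimes>\<^bsub>Aut_def M G\<^esub> \<Phi> \<sigma> \<otimes>\<^bsub>Aut_def M G\<^esub> transport \<sigma> (carrier G) \<phi>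
        \<longleftrightarrow> \<phi> \<otimes>\<^bsub>Aut_def M G\<^esub> \<Psi> \<sigma> = \<Phi> \<sigma> \<otimes>\<^bsub>Aut_def M G\<^esub> transport \<sigma> (carrier G) \<phi>"
      using Aut.inv_solve_left[OF \<Psi> \<phi> Aut.m_closed[OF \<Phi> t]] \<phi> \<Phi> t
      by (auto simp: Aut.m_assoc)
    also have "\<dots> \<longleftrightarrow> (\<forall>x \<in> carrier G.
        \<phi> (\<Psi> \<sigma> (map \<sigma> x)) = \<Phi> \<sigma> (map \<sigma> (\<phi> x)))"
      using eqI_Aut_def[OF Aut.m_closed[OF \<phi> \<Psi>] Aut.m_closed[OF \<Phi> t] \<sigma>]
      by (simp add: mult_transport_apply[OF \<Phi> \<phi> \<sigma>] mult_Aut_def[OF \<phi> \<Psi>] compose_def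
          definable_group_automorphism(1)[OF G \<sigma>])
    finally show ?thesis .
  qed
  then show ?thesis
    unfolding cohomologous_rel_def by blast
qed

section \<open>The cocycle of a form\<close>

lemma form_group: "H \<in> A_forms M A G \<Longrightarrow> definable_group M A H"
  by (simp add: A_forms_def)

lemma equiv_A_iso_rel: "equiv (A_forms M A G) (A_iso_rel M A G)"
proof (rule equivI)
  show "refl_on (A_forms M A G) (A_iso_rel M A G)"
    unfolding refl_on_def A_iso_rel_def
    using definable_isos_id[OF atomic homogeneous form_group] by blast
  show "sym (A_iso_rel M A G)"
    unfolding sym_def A_iso_rel_def
    using definable_isos_inv[OF definable_group_group[OF form_group]] by blast
  show "trans (A_iso_rel M A G)"
    unfolding trans_def A_iso_rel_def using definable_isos_comp by blast
qed (auto simp: A_iso_rel_def)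

lemma form_cocycle_mem:
  assumes H: "H \<in> A_forms M A G" and f: "f \<in> definable_isos M UNIV G H" and \<sigma>: "\<sigma> \<in> \<Gamma>"
  shows "form_cocycle M A G f \<sigma> \<in> carrier (Aut_def M G)"
proof -
  have "inv_into (carrier G) f \<circ> transport \<sigma> (carrier G) f \<in> definable_isos M UNIV G G"
    by (rule definable_isos_comp[OF definable_isos_transport[OF G form_group[OF H] f \<sigma>]
          definable_isos_inv[OF G.is_group f]])
  from restrict_in_Aut_def[OF this] show ?thesis
    using \<sigma> by (simp add: form_cocycle_def comp_def)
qed

lemma form_cocycle_apply:
  assumes H: "H \<in> A_forms M A G" and f: "f \<in> definable_isos M UNIV G H" and \<sigma>: "\<sigma> \<in> \<Gamma>"
    and x: "x \<in> carrier G"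
  shows "form_cocycle M A G f \<sigma> x \<in> carrier G"
    and "f (form_cocycle M A G f \<sigma> x) = transport \<sigma> (carrier G) f x"
    and "f (form_cocycle M A G f \<sigma> (map \<sigma> x)) = map \<sigma> (f x)"
proof -
  have *: "f (form_cocycle M A G f \<sigma> y) = transport \<sigma> (carrier G) f y" if "y \<in> carrier G" for y
  proof -
    have "transport \<sigma> (carrier G) f y \<in> f ` carrier G"
      using definable_isos_apply(1)[OF definable_isos_transport[OF G form_group[OF H] f \<sigma>] that]
        definable_isos_apply(3)[OF f] by simp
    then show ?thesis
      using \<sigma> that by (simp add: form_cocycle_def f_inv_into_f)
  qed
  show "f (form_cocycle M A G f \<sigma> x) = transport \<sigma> (carrier G) f x"
    by (rule *) (rule x)
  show "f (form_cocycle M A G f \<sigma> (map \<sigma> x)) = map \<sigma> (f x)"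
    using *[OF definable_group_automorphism(1)[OF G \<sigma> x]] x by (simp add: transport_apply[OF \<sigma>])
  show "form_cocycle M A G f \<sigma> x \<in> carrier G"
    using form_cocycle_mem[OF H f \<sigma>] x definable_isos_apply(1) by (metis mem_Aut_def)
qed

text \<open>
  The equation \<open>f(\<Phi>(\<sigma>)(\<sigma>(x))) = \<sigma>(f(x))\<close> says that \<open>f \<circ> \<Phi>(\<sigma>) = \<sigma>(f)\<close>, which determines \<open>\<Phi>(\<sigma>)\<close> as
  \<open>f\<close> is injective.
\<close>

lemma form_cocycle_eqI:
  assumes H: "H \<in> A_forms M A G" and f: "f \<in> definable_isos M UNIV G H"
    and \<Phi>: "\<Phi> \<in> \<Gamma> \<rightarrow>\<^sub>E carrier (Aut_def M G)"
    and eq: "\<And>\<sigma> x. \<sigma> \<in> \<Gamma> \<Longrightarrow> x \<in> carrier G \<Longrightarrow> f (\<Phi> \<sigma> (map \<sigma> x)) = map \<sigma> (f x)"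
  shows "form_cocycle M A G f = \<Phi>"
proof (rule extensionalityI)
  show "form_cocycle M A G f \<in> extensional \<Gamma>" "\<Phi> \<in> extensional \<Gamma>"
    using \<Phi> by (auto simp: form_cocycle_def PiE_def)
  fix \<sigma> assume \<sigma>: "\<sigma> \<in> \<Gamma>"
  then have mem: "\<Phi> \<sigma> \<in> carrier (Aut_def M G)"
    using \<Phi> by auto
  have "form_cocycle M A G f \<sigma> (map \<sigma> x) = \<Phi> \<sigma> (map \<sigma> x)" if x: "x \<in> carrier G" for x
  proof -
    have x': "map \<sigma> x \<in> carrier G"
      by (rule definable_group_automorphism(1)[OF G \<sigma> x])
    then have "\<Phi> \<sigma> (map \<sigma> x) \<in> carrier G"
      using mem definable_isos_apply(1) by (metis mem_Aut_def)
    with form_cocycle_apply(1)[OF H f \<sigma> x'] form_cocycle_apply(3)[OF H f \<sigma> x] eq[OF \<sigma> x]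
    show ?thesis
      using definable_isos_apply(2)[OF f] by metis
  qed
  then show "form_cocycle M A G f \<sigma> = \<Phi> \<sigma>"
    using eqI_Aut_def[OF form_cocycle_mem[OF H f \<sigma>] mem \<sigma>] by blast
qed

lemma form_cocycle_in_cocycles:
  assumes H: "H \<in> A_forms M A G" and f: "f \<in> definable_isos M UNIV G H"
  shows "form_cocycle M A G f \<in> cocycles M A G"
proof -
  let ?\<Phi> = "form_cocycle M A G f"
  have "?\<Phi> (\<sigma> \<circ> \<tau>) (map \<sigma> x) = ?\<Phi> \<sigma> (map \<sigma> (?\<Phi> \<tau> x))"
    if \<sigma>: "\<sigma> \<in> \<Gamma>" and \<tau>: "\<tau> \<in> \<Gamma>" and x: "x \<in> carrier G" for \<sigma> \<tau> x
  proof -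
    obtain y where y: "y \<in> carrier G" "x = map \<tau> y"
      using carrier_cases[OF G \<tau> x] by blast
    note \<sigma>\<tau> = automorphism_comp[OF \<sigma> \<tau>]
    have \<Phi>x: "?\<Phi> \<tau> x \<in> carrier G"
      by (rule form_cocycle_apply(1)[OF H f \<tau> x])
    have "f (?\<Phi> (\<sigma> \<circ> \<tau>) (map \<sigma> x)) = map \<sigma> (map \<tau> (f y))"
      using form_cocycle_apply(3)[OF H f \<sigma>\<tau> y(1)] y(2) by simp
    also have "\<dots> = map \<sigma> (f (?\<Phi> \<tau> x))"
      using form_cocycle_apply(3)[OF H f \<tau> y(1)] y(2) by simp
    also have "\<dots> = f (?\<Phi> \<sigma> (map \<sigma> (?\<Phi> \<tau> x)))"
      by (rule form_cocycle_apply(3)[OF H f \<sigma> \<Phi>x, symmetric])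
    finally show ?thesis
      using definable_isos_apply(2)[OF f]
        form_cocycle_apply(1)[OF H f \<sigma>\<tau> definable_group_automorphism(1)[OF G \<sigma> x]]
        form_cocycle_apply(1)[OF H f \<sigma> definable_group_automorphism(1)[OF G \<sigma> \<Phi>x]]
      by blast
  qed
  moreover have "?\<Phi> \<in> \<Gamma> \<rightarrow>\<^sub>E carrier (Aut_def M G)"
    using form_cocycle_mem[OF H f] by (auto simp: form_cocycle_def PiE_def)
  ultimately show ?thesis
    unfolding mem_cocycles by blast
qed

text \<open>
  With \<open>f = f\<^sub>a\<close> a member of a parameter-free family, the cocycle is \<open>f\<^sub>a\<inverse> \<circ> f\<^bsub>\<sigma>(a)\<^esub>\<close>. The required
  function is \<open>h(x, y, z) = f\<^sub>x\<inverse>(f\<^sub>y(z))\<close>, with \<open>x\<close> and \<open>y\<close> ranging over the orbit of \<open>a\<close> so that only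
  conjugates of \<open>f\<close> occur and \<open>h\<close> is single-valued.
\<close>

lemma form_cocycle_definable:
  assumes H: "H \<in> A_forms M A G" and f: "f \<in> definable_isos M UNIV G H"
  shows "form_cocycle M A G f \<in> definable_cocycles M A G"
proof -
  have "definable_map M UNIV (carrier G) f"
    using f by (simp add: definable_isos_def)
  then obtain n m a Y where n: "carrier G \<subseteq> tuples n" and m: "f ` carrier G \<subseteq> tuples m"
    and Y: "definable_set M {} (n + m + length a) Y"
    and fY: "\<And>\<sigma> z. \<sigma> \<in> \<Gamma> \<Longrightarrow> length z = n + m \<Longrightarrow>
      z @ map \<sigma> a \<in> Y \<longleftrightarrow> z \<in> graph_on (map \<sigma> ` carrier G) (transport \<sigma> (carrier G) f)"
    using definable_map_family[of M "carrier G" f A] by metis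
  obtain n' where "definable_set M A n' (carrier G)"
    using G by (rule definable_groupE)
  have "n' = n"
    using subsetD[OF definable_set_subset[OF \<open>definable_set M A n' (carrier G)\<close>] G.one_closed]
      subsetD[OF n G.one_closed] by simp
  note GA = \<open>definable_set M A n' (carrier G)\<close>[unfolded \<open>n' = n\<close>]
  note O = definable_orbit[OF atomic homogeneous, of a]
  have fY': "z @ u @ map \<sigma> a \<in> Y \<longleftrightarrow> u = transport \<sigma> (carrier G) f z"
    if "\<sigma> \<in> \<Gamma>" and "z \<in> carrier G" and "length u = m" for \<sigma> z u
    using that fY[of \<sigma> "z @ u"] n graph_on_append_iff[OF n, of z u]
    by (auto simp: image_carrier[OF G] subset_iff)
  define Q where "Q x y z w \<longleftrightarrow> x \<in> orbit M A a \<and> y \<in> orbit M A a \<and> z \<in> carrier G \<and> w \<in> carrier G \<and>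
    (\<exists>u \<in> tuples m. z @ u @ y \<in> Y \<and> w @ u @ x \<in> Y)" for x y z w
  have Q_iff: "Q (map \<sigma> a) (map \<tau> a) z w \<longleftrightarrow> z \<in> carrier G \<and> w \<in> carrier G \<and>
      transport \<sigma> (carrier G) f w = transport \<tau> (carrier G) f z" if \<sigma>: "\<sigma> \<in> \<Gamma>" and \<tau>: "\<tau> \<in> \<Gamma>" for \<sigma> \<tau> z w
  proof -
    have "length (transport \<tau> (carrier G) f z) = m" if "z \<in> carrier G"
    proof -
      have "transport \<tau> (carrier G) f z \<in> f ` carrier G"
        using definable_isos_apply(1)[OF definable_isos_transport[OF G form_group[OF H] f \<tau>] that]
        by (simp add: definable_isos_apply(3)[OF f])
      with m show ?thesis by auto
    qed
    moreover have "map \<sigma> a \<in> orbit M A a" "map \<tau> a \<in> orbit M A a"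
      using \<sigma> \<tau> by (auto simp: orbit_def)
    ultimately show ?thesis
      unfolding Q_def using fY'[OF \<sigma>] fY'[OF \<tau>] by auto
  qed
  have unique: "w = w'" if Q: "Q x y z w" "Q x y z w'" for x y z w w'
  proof -
    obtain \<sigma> \<tau> where \<sigma>: "\<sigma> \<in> \<Gamma>" "x = map \<sigma> a" and \<tau>: "\<tau> \<in> \<Gamma>" "y = map \<tau> a"
      using Q(1) unfolding Q_def orbit_def by blast
    show ?thesis
      using Q definable_isos_apply(2)[OF definable_isos_transport[OF G form_group[OF H] f \<sigma>(1)], of w w']
      by (simp add: \<sigma>(2) \<tau>(2) Q_iff[OF \<sigma>(1) \<tau>(1)])
  qed
  define h where "h x y z = (if \<exists>w. Q x y z w then Some (THE w. Q x y z w) else None)" for x y z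
  have h: "h x y z = Some w \<longleftrightarrow> Q x y z w" for x y z w
    unfolding h_def using unique by (auto intro: the_equality theI)
  have lengths: "length x = length a \<and> length y = length a \<and> length z = n \<and> length w = n"
    if "Q x y z w" for x y z w
    using that n unfolding Q_def orbit_def by auto
  have "definable_partial_fun3 M A h"
    unfolding definable_partial_fun3_def
  proof (intro exI conjI allI impI)
    show "x \<in> tuples (length a)" "y \<in> tuples (length a)" "z \<in> tuples n" "w \<in> tuples n"
      if "h x y z = Some w" for x y z w
      using lengths that by (auto simp: h)
    have "{x @ y @ z @ w | x y z w. h x y z = Some w} = {x @ y @ z @ w | x y z w.
        length x = length a \<and> length y = length a \<and> length z = n \<and> length w = n \<and> Q x y z w}"
      unfolding h using lengths by (intro Collect_cong) (metis (no_types))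
    also have "definable_set M A (length a + length a + n + n) \<dots>"
      unfolding Q_def
      by (intro definable_blocks4 definable_intros definable_pred_mem[OF O] definable_pred_mem[OF GA]
          definable_pred_mem[OF definable_set_mono[OF Y empty_subsetI]])
    finally show "definable_set M A (length a + length a + n + n)
      {x @ y @ z @ w | x y z w. h x y z = Some w}" .
  qed
  moreover have "h a (map \<sigma> a) z = Some (form_cocycle M A G f \<sigma> z)"
    if \<sigma>: "\<sigma> \<in> \<Gamma>" and z: "z \<in> carrier G" for \<sigma> z
  proof -
    have "transport id (carrier G) f w = f w" if "w \<in> carrier G" for w
      using transport_apply[OF automorphism_id that, of f] by simp
    then have "Q (map id a) (map \<sigma> a) z (form_cocycle M A G f \<sigma> z)"
      using Q_iff[OF automorphism_id \<sigma>] z form_cocycle_apply(1,2)[OF H f \<sigma> z] by simp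
    then show ?thesis
      by (simp add: h)
  qed
  ultimately show ?thesis
    unfolding definable_cocycles_def using form_cocycle_in_cocycles[OF H f] by blast
qed

text \<open>
  A cohomology \<open>\<phi>\<close> between the cocycles corresponds to the isomorphism \<open>\<theta> = f \<circ> \<phi> \<circ> g\<inverse>\<close>. Both
  directions compare \<open>\<theta>(\<sigma>(y))\<close> with \<open>\<sigma>(\<theta>(y))\<close> at \<open>y = g(x)\<close>: the first equals
  \<open>f(\<phi>(\<Psi>(\<sigma>)(\<sigma>(x))))\<close> and the second \<open>f(\<Phi>(\<sigma>)(\<sigma>(\<phi>(x))))\<close>.
\<close>

lemma cohomologous_iff_A_iso:
  assumes H: "H \<in> A_forms M A G" and f: "f \<in> definable_isos M UNIV G H"
    and K: "K \<in> A_forms M A G" and g: "g \<in> definable_isos M UNIV G K"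
  shows "(form_cocycle M A G f, form_cocycle M A G g) \<in> cohomologous_rel M A G
    \<longleftrightarrow> (K, H) \<in> A_iso_rel M A G"
proof -
  let ?\<Phi> = "form_cocycle M A G f" and ?\<Psi> = "form_cocycle M A G g"
  note f_apply = form_cocycle_apply[OF H f] and g_apply = form_cocycle_apply[OF K g]
  note aut = definable_group_automorphism(1)[OF G]
  show ?thesis
  proof
    assume "(?\<Phi>, ?\<Psi>) \<in> cohomologous_rel M A G"
    then obtain \<phi> where "\<phi> \<in> carrier (Aut_def M G)"
      and eq: "\<And>\<sigma> x. \<sigma> \<in> \<Gamma> \<Longrightarrow> x \<in> carrier G \<Longrightarrow> \<phi> (?\<Psi> \<sigma> (map \<sigma> x)) = ?\<Phi> \<sigma> (map \<sigma> (\<phi> x))"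
      unfolding mem_cohomologous_rel by blast
    then have \<phi>: "\<phi> \<in> definable_isos M UNIV G G"
      by (simp add: mem_Aut_def)
    define \<theta> where "\<theta> = f \<circ> (\<phi> \<circ> inv_into (carrier G) g)"
    have \<theta>: "\<theta> \<in> definable_isos M UNIV K H"
      unfolding \<theta>_def
      by (intro definable_isos_comp[OF definable_isos_comp[OF definable_isos_inv[OF G.is_group g] \<phi>] f])
    have \<theta>g: "\<theta> (g x) = f (\<phi> x)" if "x \<in> carrier G" for x
      using inv_into_f_f[OF definable_isos_apply(4)[OF g] that] by (simp add: \<theta>_def)
    have "\<theta> (map \<sigma> y) = map \<sigma> (\<theta> y)" if \<sigma>: "\<sigma> \<in> \<Gamma>" and "y \<in> carrier K" for \<sigma> y
    proof -
      obtain x where x: "x \<in> carrier G" "y = g x"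
        using \<open>y \<in> carrier K\<close> definable_isos_apply(3)[OF g] by blast
      have "\<theta> (map \<sigma> y) = \<theta> (g (?\<Psi> \<sigma> (map \<sigma> x)))"
        using g_apply(3)[OF \<sigma> x(1)] x(2) by simp
      also have "\<dots> = f (?\<Phi> \<sigma> (map \<sigma> (\<phi> x)))"
        using \<theta>g[OF g_apply(1)[OF \<sigma> aut[OF \<sigma> x(1)]]] eq[OF \<sigma> x(1)] by simp
      also have "\<dots> = map \<sigma> (f (\<phi> x))"
        by (rule f_apply(3)[OF \<sigma> definable_isos_apply(1)[OF \<phi> x(1)]])
      finally show ?thesis
        using \<theta>g[OF x(1)] x(2) by simp
    qed
    then have "definable_map M A (carrier K) \<theta>"
      using \<theta> definable_group_automorphism(1)[OF form_group[OF K]]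
      by (intro definable_map_invariant[OF atomic homogeneous]) (auto simp: definable_isos_def)
    with \<theta> have "\<theta> \<in> definable_isos M A K H"
      by (simp add: definable_isos_def)
    with H K show "(K, H) \<in> A_iso_rel M A G"
      unfolding A_iso_rel_def by blast
  next
    assume "(K, H) \<in> A_iso_rel M A G"
    then obtain \<theta> where \<theta>: "\<theta> \<in> definable_isos M A K H"
      unfolding A_iso_rel_def by blast
    then have \<theta>U: "\<theta> \<in> definable_isos M UNIV K H"
      using definable_isos_mono[of A UNIV] by blast
    define \<phi> where "\<phi> = restrict (inv_into (carrier G) f \<circ> (\<theta> \<circ> g)) (carrier G)"
    have \<phi>: "\<phi> \<in> carrier (Aut_def M G)"
      unfolding \<phi>_def
      by (intro restrict_in_Aut_def definable_isos_comp[OF definable_isos_comp[OF g \<theta>U]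
            definable_isos_inv[OF G.is_group f]])
    then have \<phi>_iso: "\<phi> \<in> definable_isos M UNIV G G"
      by (simp add: mem_Aut_def)
    have f\<phi>: "f (\<phi> x) = \<theta> (g x)" if "x \<in> carrier G" for x
    proof -
      have "\<theta> (g x) \<in> f ` carrier G"
        using that definable_isos_apply(1)[OF \<theta>] definable_isos_apply(1)[OF g]
        by (simp add: definable_isos_apply(3)[OF f])
      then show ?thesis
        using that by (simp add: \<phi>_def f_inv_into_f)
    qed
    have "\<phi> (?\<Psi> \<sigma> (map \<sigma> x)) = ?\<Phi> \<sigma> (map \<sigma> (\<phi> x))" if \<sigma>: "\<sigma> \<in> \<Gamma>" and x: "x \<in> carrier G" for \<sigma> x
    proof -
      note \<Psi>x = g_apply(1)[OF \<sigma> aut[OF \<sigma> x]] and \<phi>x = definable_isos_apply(1)[OF \<phi>_iso x]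
      have "f (\<phi> (?\<Psi> \<sigma> (map \<sigma> x))) = \<theta> (map \<sigma> (g x))"
        using f\<phi>[OF \<Psi>x] g_apply(3)[OF \<sigma> x] by simp
      also have "\<dots> = map \<sigma> (\<theta> (g x))"
        using \<theta> definable_map_automorphism(2)[OF _ \<sigma> definable_isos_apply(1)[OF g x]]
        by (simp add: definable_isos_def)
      also have "\<dots> = f (?\<Phi> \<sigma> (map \<sigma> (\<phi> x)))"
        using f\<phi>[OF x] f_apply(3)[OF \<sigma> \<phi>x] by simp
      finally show ?thesis
        using definable_isos_apply(2)[OF f definable_isos_apply(1)[OF \<phi>_iso \<Psi>x] f_apply(1)[OF \<sigma> aut[OF \<sigma> \<phi>x]]]
        by blast
    qed
    then show "(?\<Phi>, ?\<Psi>) \<in> cohomologous_rel M A G"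
      unfolding mem_cohomologous_rel
      using \<phi> form_cocycle_definable[OF H f] form_cocycle_definable[OF K g] by blast
  qed
qed

lemma id_in_definable_isos: "(\<lambda>x. x) \<in> definable_isos M UNIV G G"
  using definable_isos_id[OF atomic homogeneous G] definable_isos_mono[of A UNIV] by blast

lemma G_in_A_forms: "G \<in> A_forms M A G"
  using id_in_definable_isos G unfolding A_forms_def by blast

lemma form_cocycle_id: "form_cocycle M A G (\<lambda>x. x) = trivial_cocycle M A G"
proof (rule form_cocycle_eqI[OF G_in_A_forms id_in_definable_isos])
  interpret Aut: group "Aut_def M G" by (rule group_Aut_def)
  show "trivial_cocycle M A G \<in> \<Gamma> \<rightarrow>\<^sub>E carrier (Aut_def M G)"
    by (auto simp: trivial_cocycle_def)
  fix \<sigma> x assume "\<sigma> \<in> \<Gamma>" "x \<in> carrier G"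
  then show "trivial_cocycle M A G \<sigma> (map \<sigma> x) = map \<sigma> x"
    using definable_group_automorphism(1)[OF G]
    by (simp add: trivial_cocycle_def Aut_def_def AutoGroup_def BijGroup_def)
qed

section \<open>The form of a cocycle\<close>

text \<open>
  Transport of structure along a definable injection \<open>f\<close>. If each conjugate \<open>\<sigma>(f)\<close> differs from \<open>f\<close>
  by an automorphism of \<open>G\<close>, then it has the same image and induces the same multiplication there,
  so both are invariant.
\<close>

lemma form_of_equivariant_injection:
  assumes f: "definable_map M UNIV (carrier G) f" and inj: "inj_on f (carrier G)"
    and \<Phi>: "\<And>\<sigma>. \<sigma> \<in> \<Gamma> \<Longrightarrow> \<Phi> \<sigma> \<in> carrier (Aut_def M G)"
    and eq: "\<And>\<sigma> x. \<sigma> \<in> \<Gamma> \<Longrightarrow> x \<in> carrier G \<Longrightarrow> f (\<Phi> \<sigma> (map \<sigma> x)) = map \<sigma> (f x)"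
  obtains H where "H \<in> A_forms M A G" and "f \<in> definable_isos M UNIV G H"
proof -
  define H where "H = \<lparr>carrier = f ` carrier G,
    mult = (\<lambda>u v. f (inv_into (carrier G) f u \<otimes>\<^bsub>G\<^esub> inv_into (carrier G) f v)), one = f \<one>\<^bsub>G\<^esub>\<rparr>"
  have iso: "f \<in> iso G H"
    using inj by (simp add: iso_def hom_def H_def bij_betw_def inv_into_f_f)
  then have "group (H\<lparr>one := f \<one>\<^bsub>G\<^esub>\<rparr>)"
    by (rule G.iso_imp_img_group)
  then have group: "group H"
    by (simp add: H_def)
  have \<Phi>_iso: "\<Phi> \<sigma> \<in> definable_isos M UNIV G G" if "\<sigma> \<in> \<Gamma>" for \<sigma>
    using \<Phi>[OF that] by (simp add: mem_Aut_def)
  obtain n m where n: "carrier G \<subseteq> tuples n" and m: "f ` carrier G \<subseteq> tuples m"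
    and f_graph: "definable_set M UNIV (n + m) (graph_on (carrier G) f)"
    using f by (rule definable_mapE)
  have f_mem: "x @ u \<in> graph_on (carrier G) f \<longleftrightarrow> x \<in> carrier G \<and> u = f x" if "length x = n" for x u
    by (rule graph_on_append_iff[OF n that])
  obtain n' where G': "definable_set M A n' (carrier G)" and mult: "definable_set M A (n' + n' + n')
      {x @ y @ (x \<otimes>\<^bsub>G\<^esub> y) | x y. x \<in> carrier G \<and> y \<in> carrier G}" (is "definable_set M A _ ?m")
    using G by (rule definable_groupE)
  have "n' = n"
    using subsetD[OF definable_set_subset[OF G'] G.one_closed] subsetD[OF n G.one_closed] by simp
  note mult = definable_set_mono[OF mult[unfolded \<open>n' = n\<close>] subset_UNIV]
  have len: "length x = n" "length (f x) = m" if "x \<in> carrier G" for x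
    using n m that by auto
  have mult_mem: "x @ y @ z \<in> ?m \<longleftrightarrow> x \<in> carrier G \<and> y \<in> carrier G \<and> z = x \<otimes>\<^bsub>G\<^esub> y"
    if "length x = n" "length y = n" for x y z
  proof
    assume "x @ y @ z \<in> ?m"
    then obtain x' y' where *: "x @ y @ z = x' @ y' @ (x' \<otimes>\<^bsub>G\<^esub> y')" and "x' \<in> carrier G" "y' \<in> carrier G"
      by blast
    then show "x \<in> carrier G \<and> y \<in> carrier G \<and> z = x \<otimes>\<^bsub>G\<^esub> y"
      using that len(1)[of x'] len(1)[of y'] by auto
  qed blast
  have carrier_def: "definable_set M A m (carrier H)"
  proof (rule definable_set_invariant[OF atomic homogeneous])
    have "definable_set M UNIV m {u \<in> tuples m. \<exists>x \<in> tuples n. x @ u \<in> graph_on (carrier G) f}"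
      by (intro definable_blocks1 definable_intros definable_pred_mem[OF f_graph])
    also have "{u \<in> tuples m. \<exists>x \<in> tuples n. x @ u \<in> graph_on (carrier G) f} = carrier H"
      using len by (auto simp: f_mem H_def)
    finally show "definable_set M UNIV m (carrier H)" .
    show "map \<sigma> u \<in> carrier H" if \<sigma>: "\<sigma> \<in> \<Gamma>" and u: "u \<in> carrier H" for \<sigma> u
    proof -
      obtain x where x: "x \<in> carrier G" "u = f x"
        using u by (auto simp: H_def)
      have "\<Phi> \<sigma> (map \<sigma> x) \<in> carrier G"
        by (rule definable_isos_apply(1)[OF \<Phi>_iso[OF \<sigma>] definable_group_automorphism(1)[OF G \<sigma> x(1)]])
      then show ?thesis
        using eq[OF \<sigma> x(1)] x(2) by (metis H_def imageI partial_object.select_convs(1))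
    qed
  qed
  let ?mH = "{u @ v @ (u \<otimes>\<^bsub>H\<^esub> v) | u v. u \<in> carrier H \<and> v \<in> carrier H}"
  have mH: "?mH = {f x @ f y @ f (x \<otimes>\<^bsub>G\<^esub> y) | x y. x \<in> carrier G \<and> y \<in> carrier G}"
  proof -
    have *: "f x \<otimes>\<^bsub>H\<^esub> f y = f (x \<otimes>\<^bsub>G\<^esub> y)" if "x \<in> carrier G" "y \<in> carrier G" for x y
      using hom_mult[of f G H x y] that iso by (simp add: iso_def)
    show ?thesis
    proof (intro equalityI subsetI)
      fix z assume "z \<in> ?mH"
      then obtain x y where "x \<in> carrier G" "y \<in> carrier G" "z = f x @ f y @ (f x \<otimes>\<^bsub>H\<^esub> f y)"
        by (auto simp: H_def)
      with * show "z \<in> {f x @ f y @ f (x \<otimes>\<^bsub>G\<^esub> y) | x y. x \<in> carrier G \<and> y \<in> carrier G}"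
        by (intro CollectI exI[of _ x] exI[of _ y]) simp
    next
      fix z assume "z \<in> {f x @ f y @ f (x \<otimes>\<^bsub>G\<^esub> y) | x y. x \<in> carrier G \<and> y \<in> carrier G}"
      then obtain x y where xy: "x \<in> carrier G" "y \<in> carrier G" "z = f x @ f y @ f (x \<otimes>\<^bsub>G\<^esub> y)"
        by blast
      then have "f x \<in> carrier H" "f y \<in> carrier H"
        by (auto simp: H_def)
      with xy * show "z \<in> ?mH"
        by (intro CollectI exI[of _ "f x"] exI[of _ "f y"]) simp
    qed
  qed
  have "definable_set M A (m + m + m) ?mH"
  proof (rule definable_set_invariant[OF atomic homogeneous])
    let ?Z = "{u @ v @ w | u v w. length u = m \<and> length v = m \<and> length w = m \<and>
      (\<exists>x \<in> tuples n. \<exists>y \<in> tuples n. \<exists>z \<in> tuples n. x @ y @ z \<in> ?m \<and> x @ u \<in> graph_on (carrier G) f \<and>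
         y @ v \<in> graph_on (carrier G) f \<and> z @ w \<in> graph_on (carrier G) f)}"
    have "definable_set M UNIV (m + m + m) ?Z"
      by (intro definable_blocks3 definable_intros definable_pred_mem[OF f_graph]
          definable_pred_mem[OF mult])
    also have "?Z = ?mH"
      unfolding mH
    proof (intro equalityI subsetI)
      fix p assume "p \<in> ?Z"
      then obtain u v w x y z where "p = u @ v @ w" "length x = n" "length y = n" "length z = n"
        "x @ y @ z \<in> ?m" "x @ u \<in> graph_on (carrier G) f" "y @ v \<in> graph_on (carrier G) f"
        "z @ w \<in> graph_on (carrier G) f" unfolding tuples_iff Bex_def by blast
      then show "p \<in> {f x @ f y @ f (x \<otimes>\<^bsub>G\<^esub> y) | x y. x \<in> carrier G \<and> y \<in> carrier G}"
        by (simp only: mult_mem f_mem) blast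
    next
      fix p assume "p \<in> {f x @ f y @ f (x \<otimes>\<^bsub>G\<^esub> y) | x y. x \<in> carrier G \<and> y \<in> carrier G}"
      then obtain x y where xy: "p = f x @ f y @ f (x \<otimes>\<^bsub>G\<^esub> y)" "x \<in> carrier G" "y \<in> carrier G"
        by blast
      let ?xy = "x \<otimes>\<^bsub>G\<^esub> y"
      have closed: "?xy \<in> carrier G" using xy by simp
      have "x @ y @ ?xy \<in> ?m" using xy by blast
      then have "\<exists>x' \<in> tuples n. \<exists>y' \<in> tuples n. \<exists>z \<in> tuples n. x' @ y' @ z \<in> ?m \<and>
          x' @ f x \<in> graph_on (carrier G) f \<and> y' @ f y \<in> graph_on (carrier G) f \<and>
          z @ f ?xy \<in> graph_on (carrier G) f"
        by (intro bexI[of _ x] bexI[of _ y] bexI[of _ ?xy] conjI)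
          (simp_all only: tuples_iff f_mem len xy(2,3) closed simp_thms)
      with xy closed show "p \<in> ?Z"
        by (intro CollectI exI[of _ "f x"] exI[of _ "f y"] exI[of _ "f ?xy"]) (simp only: len simp_thms)
    qed
    finally show "definable_set M UNIV (m + m + m) ?mH" .
    show "map \<sigma> p \<in> ?mH" if \<sigma>: "\<sigma> \<in> \<Gamma>" and pH: "p \<in> ?mH" for \<sigma> p
    proof -
      obtain x y where p: "p = f x @ f y @ f (x \<otimes>\<^bsub>G\<^esub> y)" and x: "x \<in> carrier G" and y: "y \<in> carrier G"
        using pH unfolding mH by blast
      note aut = definable_group_automorphism[OF G \<sigma>]
      note closed = definable_isos_apply(1)[OF \<Phi>_iso[OF \<sigma>]]
      have "\<Phi> \<sigma> \<in> hom G G"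
        using \<Phi>_iso[OF \<sigma>] by (simp add: definable_isos_def iso_def)
      then have "map \<sigma> (f (x \<otimes>\<^bsub>G\<^esub> y)) = f (\<Phi> \<sigma> (map \<sigma> x) \<otimes>\<^bsub>G\<^esub> \<Phi> \<sigma> (map \<sigma> y))"
        using eq[OF \<sigma>, of "x \<otimes>\<^bsub>G\<^esub> y"] x y aut by (simp add: hom_mult)
      then have "map \<sigma> p = f (\<Phi> \<sigma> (map \<sigma> x)) @ f (\<Phi> \<sigma> (map \<sigma> y)) @
          f (\<Phi> \<sigma> (map \<sigma> x) \<otimes>\<^bsub>G\<^esub> \<Phi> \<sigma> (map \<sigma> y))"
        using p eq[OF \<sigma> x] eq[OF \<sigma> y] by simp
      then show ?thesis
        unfolding mH using closed[OF aut(1)[OF x]] closed[OF aut(1)[OF y]] by blast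
    qed
  qed
  with group carrier_def have "definable_group M A H"
    unfolding definable_group_def by blast
  moreover have "f \<in> definable_isos M UNIV G H"
    using iso f by (simp add: definable_isos_def)
  ultimately show thesis
    using that unfolding A_forms_def by blast
qed

lemma cocycle_id:
  assumes \<Phi>: "\<Phi> \<in> cocycles M A G" and x: "x \<in> carrier G"
  shows "\<Phi> id x = x"
proof -
  note iso = cocycle_mem(1)[OF \<Phi> automorphism_id]
  have "\<Phi> (id \<circ> id) (map id x) = \<Phi> id (map id (\<Phi> id x))"
    using \<Phi> automorphism_id x unfolding mem_cocycles by blast
  then have "\<Phi> id x = \<Phi> id (\<Phi> id x)"
    by simp
  then show ?thesis
    using definable_isos_apply(2)[OF iso x definable_isos_apply(1)[OF iso x]] by simp
qed

text \<open>
  The descent construction. The relation \<open>\<epsilon>\<close> holds between two names \<open>(\<sigma>(a), z)\<close> and \<open>(\<tau>(a), z')\<close>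
  of the same element \<open>\<Phi>(\<sigma>)(z) = \<Phi>(\<tau>)(z')\<close>. It is symmetric and transitive, so two names have the
  same section in \<open>\<epsilon>\<close> exactly if they are related.
\<close>

lemma definable_cocycle_form:
  assumes EI: "eliminates_imaginaries M" and "\<Phi> \<in> definable_cocycles M A G"
  obtains H f where "H \<in> A_forms M A G" and "f \<in> definable_isos M UNIV G H"
    and "form_cocycle M A G f = \<Phi>"
proof -
  obtain a h where \<Phi>: "\<Phi> \<in> cocycles M A G" and "definable_partial_fun3 M A h"
    and h\<Phi>: "\<And>\<sigma> z. \<sigma> \<in> \<Gamma> \<Longrightarrow> z \<in> carrier G \<Longrightarrow> h a (map \<sigma> a) z = Some (\<Phi> \<sigma> z)"
    using assms(2) unfolding definable_cocycles_def by blast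
  obtain k' l' n' m' where h_len: "\<And>x y z w. h x y z = Some w \<Longrightarrow>
      x \<in> tuples k' \<and> y \<in> tuples l' \<and> z \<in> tuples n' \<and> w \<in> tuples m'"
    and h_def: "definable_set M A (k' + l' + n' + m') {x @ y @ z @ w | x y z w. h x y z = Some w}"
    using \<open>definable_partial_fun3 M A h\<close> unfolding definable_partial_fun3_def by blast
  obtain n where n: "definable_set M A n (carrier G)"
    using G by (rule definable_groupE)
  have len: "length x = n" if "x \<in> carrier G" for x
    using definable_set_subset[OF n] that by auto
  define k where "k = length a"
  note \<Phi>_iso = cocycle_mem(1)[OF \<Phi>]
  note aut = definable_group_automorphism(1)[OF G]
  have coc: "\<Phi> (\<sigma> \<circ> \<tau>) (map \<sigma> x) = \<Phi> \<sigma> (map \<sigma> (\<Phi> \<tau> x))"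
    if "\<sigma> \<in> \<Gamma>" "\<tau> \<in> \<Gamma>" "x \<in> carrier G" for \<sigma> \<tau> x
    using \<Phi> that unfolding mem_cocycles by blast
  define hg where "hg = {x @ y @ z @ w | x y z w. h x y z = Some w}"
  \<comment> \<open>The lengths of the arguments of \<open>h\<close> can be read off the one value at \<open>\<sigma> = id\<close>, \<open>z = 1\<close>.\<close>
  have "k' = k \<and> l' = k \<and> n' = n \<and> m' = n"
    using h_len[OF h\<Phi>[OF automorphism_id G.one_closed]] len
      definable_isos_apply(1)[OF \<Phi>_iso[OF automorphism_id] G.one_closed]
    by (auto simp: k_def)
  note dims = this
  have hg: "definable_set M A (k + k + n + n) hg"
    using h_def dims by (simp add: hg_def)
  have hg_mem: "a @ map \<sigma> a @ z @ w \<in> hg \<longleftrightarrow> w = \<Phi> \<sigma> z"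
    if \<sigma>: "\<sigma> \<in> \<Gamma>" and z: "z \<in> carrier G" for \<sigma> z w
  proof
    assume "a @ map \<sigma> a @ z @ w \<in> hg"
    then obtain x y z' w' where *: "a @ map \<sigma> a @ z @ w = x @ y @ z' @ w'" "h x y z' = Some w'"
      unfolding hg_def by blast
    then have "length x = k" "length y = k" "length z' = n"
      using h_len[OF *(2)] dims by auto
    then have "x = a \<and> y = map \<sigma> a \<and> z' = z \<and> w' = w"
      using *(1) len[OF z] by (auto simp: k_def)
    then show "w = \<Phi> \<sigma> z"
      using *(2) h\<Phi>[OF \<sigma> z] by simp
  next
    assume "w = \<Phi> \<sigma> z"
    then show "a @ map \<sigma> a @ z @ w \<in> hg"
      unfolding hg_def using h\<Phi>[OF \<sigma> z] by blast
  qed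
  note O = definable_orbit[OF atomic homogeneous, of a]
  \<comment> \<open>The form of this relation makes it definable with parameter \<open>a\<close>; for names it says that the
    elements named agree.\<close>
  define R where "R x z y z' \<longleftrightarrow> x \<in> orbit M A a \<and> y \<in> orbit M A a \<and> z \<in> carrier G \<and> z' \<in> carrier G \<and>
    (\<exists>w \<in> tuples n. a @ x @ z @ w \<in> hg \<and> a @ y @ z' @ w \<in> hg)" for x z y z'
  define \<epsilon> where "\<epsilon> = {x @ z @ y @ z' | x z y z'.
    length x = k \<and> length z = n \<and> length y = k \<and> length z' = n \<and> R x z y z'}"
  have R: "R (map \<sigma> a) z (map \<tau> a) z' \<longleftrightarrow> z \<in> carrier G \<and> z' \<in> carrier G \<and> \<Phi> \<sigma> z = \<Phi> \<tau> z'"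
    if \<sigma>: "\<sigma> \<in> \<Gamma>" and \<tau>: "\<tau> \<in> \<Gamma>" for \<sigma> \<tau> z z'
  proof -
    have "map \<sigma> a \<in> orbit M A a" "map \<tau> a \<in> orbit M A a"
      using \<sigma> \<tau> by (auto simp: orbit_def)
    then show ?thesis
      unfolding R_def using hg_mem[OF \<sigma>] hg_mem[OF \<tau>]
        len[OF definable_isos_apply(1)[OF \<Phi>_iso[OF \<tau>]]] by auto
  qed
  have \<epsilon>_cases: "\<exists>\<sigma> \<in> \<Gamma>. \<exists>\<tau> \<in> \<Gamma>. \<exists>z \<in> carrier G. \<exists>z' \<in> carrier G.
      p = map \<sigma> a @ z @ map \<tau> a @ z' \<and> \<Phi> \<sigma> z = \<Phi> \<tau> z'" if p: "p \<in> \<epsilon>" for p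
  proof -
    obtain x z y z' where *: "p = x @ z @ y @ z'" "R x z y z'"
      using p unfolding \<epsilon>_def by blast
    then obtain \<sigma> \<tau> where \<sigma>\<tau>: "\<sigma> \<in> \<Gamma>" "x = map \<sigma> a" "\<tau> \<in> \<Gamma>" "y = map \<tau> a"
      unfolding R_def orbit_def by blast
    then have "z \<in> carrier G" "z' \<in> carrier G" "\<Phi> \<sigma> z = \<Phi> \<tau> z'"
      using *(2) R[of \<sigma> \<tau> z z'] by auto
    with *(1) \<sigma>\<tau> show ?thesis by blast
  qed
  have \<epsilon>_mem: "map \<sigma> a @ z @ map \<tau> a @ z' \<in> \<epsilon> \<longleftrightarrow> \<Phi> \<sigma> z = \<Phi> \<tau> z'"
    if \<sigma>: "\<sigma> \<in> \<Gamma>" and \<tau>: "\<tau> \<in> \<Gamma>" and z: "z \<in> carrier G" and z': "z' \<in> carrier G" for \<sigma> \<tau> z z'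
  proof
    assume "map \<sigma> a @ z @ map \<tau> a @ z' \<in> \<epsilon>"
    then obtain x u y u' where *: "map \<sigma> a @ z @ map \<tau> a @ z' = x @ u @ y @ u'"
      "length x = k" "length u = n" "length y = k" "R x u y u'"
      unfolding \<epsilon>_def by blast
    then have "R (map \<sigma> a) z (map \<tau> a) z'"
      using len[OF z] by (simp add: k_def)
    then show "\<Phi> \<sigma> z = \<Phi> \<tau> z'"
      by (simp add: R[OF \<sigma> \<tau>])
  next
    assume "\<Phi> \<sigma> z = \<Phi> \<tau> z'"
    then have "R (map \<sigma> a) z (map \<tau> a) z'"
      using z z' by (simp add: R[OF \<sigma> \<tau>])
    then show "map \<sigma> a @ z @ map \<tau> a @ z' \<in> \<epsilon>"
      unfolding \<epsilon>_def using len[OF z] len[OF z']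
      by (intro CollectI exI[of _ "map \<sigma> a"] exI[of _ z] exI[of _ "map \<tau> a"] exI[of _ z'])
        (simp add: k_def)
  qed
  have "definable_set M UNIV (k + n + k + n) \<epsilon>"
    unfolding \<epsilon>_def R_def
    by (intro definable_blocks4 definable_intros subset_UNIV
        definable_pred_mem[OF definable_set_mono[OF O subset_UNIV]]
        definable_pred_mem[OF definable_set_mono[OF n subset_UNIV]]
        definable_pred_mem[OF definable_set_mono[OF hg subset_UNIV]])
  then have "definable_set M A (k + n + k + n) \<epsilon>"
  proof (rule definable_set_invariant[OF atomic homogeneous])
    show "map \<rho> p \<in> \<epsilon>" if \<rho>: "\<rho> \<in> \<Gamma>" and "p \<in> \<epsilon>" for \<rho> p
    proof -
      obtain \<sigma> \<tau> z z' where *: "\<sigma> \<in> \<Gamma>" "\<tau> \<in> \<Gamma>" "z \<in> carrier G" "z' \<in> carrier G"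
        "p = map \<sigma> a @ z @ map \<tau> a @ z'" "\<Phi> \<sigma> z = \<Phi> \<tau> z'"
        using \<epsilon>_cases[OF \<open>p \<in> \<epsilon>\<close>] by blast
      have "\<Phi> (\<rho> \<circ> \<sigma>) (map \<rho> z) = \<Phi> (\<rho> \<circ> \<tau>) (map \<rho> z')"
        using coc[OF \<rho>] * by simp
      then show ?thesis
        using \<epsilon>_mem[OF automorphism_comp[OF \<rho> *(1)] automorphism_comp[OF \<rho> *(2)]
            aut[OF \<rho> *(3)] aut[OF \<rho> *(4)]] by (simp add: *(5))
    qed
  qed
  then have "definable_set M A ((k + n) + (k + n)) \<epsilon>"
    by (simp add: add.assoc)
  then obtain q m where q_ran: "q ` tuples (k + n) \<subseteq> tuples m"
    and q_def: "definable_set M A (k + n + m) (graph_on (tuples (k + n)) q)"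
    and q_ker: "\<And>x y. length x = k + n \<Longrightarrow> length y = k + n \<Longrightarrow>
      q x = q y \<longleftrightarrow> (\<forall>z \<in> tuples (k + n). x @ z \<in> \<epsilon> \<longleftrightarrow> y @ z \<in> \<epsilon>)"
    by (rule definable_section_code[OF EI]) (rule that, simp_all)
  \<comment> \<open>Taking \<open>p\<close> to be the second name itself gives one direction.\<close>
  have q_eq: "q (map \<sigma> a @ z) = q (map \<tau> a @ z') \<longleftrightarrow> \<Phi> \<sigma> z = \<Phi> \<tau> z'"
    if \<sigma>: "\<sigma> \<in> \<Gamma>" and \<tau>: "\<tau> \<in> \<Gamma>" and z: "z \<in> carrier G" and z': "z' \<in> carrier G" for \<sigma> \<tau> z z'
  proof -
    have ker: "q (map \<sigma> a @ z) = q (map \<tau> a @ z') \<longleftrightarrow>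
        (\<forall>p \<in> tuples (k + n). map \<sigma> a @ z @ p \<in> \<epsilon> \<longleftrightarrow> map \<tau> a @ z' @ p \<in> \<epsilon>)"
      using q_ker[of "map \<sigma> a @ z" "map \<tau> a @ z'"] len[OF z] len[OF z'] by (simp add: k_def)
    show ?thesis
    proof
      assume "q (map \<sigma> a @ z) = q (map \<tau> a @ z')"
      then have "map \<sigma> a @ z @ map \<tau> a @ z' \<in> \<epsilon> \<longleftrightarrow> map \<tau> a @ z' @ map \<tau> a @ z' \<in> \<epsilon>"
        using ker len[OF z'] by (simp add: k_def)
      then show "\<Phi> \<sigma> z = \<Phi> \<tau> z'"
        by (simp add: \<epsilon>_mem \<sigma> \<tau> z z')
    next
      assume eq: "\<Phi> \<sigma> z = \<Phi> \<tau> z'"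
      have sub: "map \<tau>' a @ y' @ p \<in> \<epsilon>" if hyp: "map \<sigma>' a @ y @ p \<in> \<epsilon>" "\<sigma>' \<in> \<Gamma>" "\<tau>' \<in> \<Gamma>"
        "y \<in> carrier G" "y' \<in> carrier G" "\<Phi> \<sigma>' y = \<Phi> \<tau>' y'" for \<sigma>' \<tau>' y y' p
      proof -
        obtain \<rho> \<rho>' u u' where *: "\<rho> \<in> \<Gamma>" "\<rho>' \<in> \<Gamma>" "u \<in> carrier G" "u' \<in> carrier G"
          "map \<sigma>' a @ y @ p = map \<rho> a @ u @ map \<rho>' a @ u'"
          using \<epsilon>_cases[OF hyp(1)] by blast
        then have p: "p = map \<rho>' a @ u'"
          using len[OF hyp(4)] len[OF *(3)] by simp
        then have "\<Phi> \<sigma>' y = \<Phi> \<rho>' u'"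
          using hyp(1) \<epsilon>_mem[OF hyp(2) *(2) hyp(4) *(4)] by simp
        then show ?thesis
          using \<epsilon>_mem[OF hyp(3) *(2) hyp(5) *(4)] hyp(6) p by simp
      qed
      show "q (map \<sigma> a @ z) = q (map \<tau> a @ z')"
        unfolding ker using sub[OF _ \<sigma> \<tau> z z' eq] sub[OF _ \<tau> \<sigma> z' z eq[symmetric]] by blast
    qed
  qed
  define f where "f z = q (a @ z)" for z
  \<comment> \<open>Since \<open>\<Phi>(id) = id\<close>, the name \<open>(a, z)\<close> denotes \<open>z\<close>.\<close>
  have f_eq: "f z = q (map \<tau> a @ z') \<longleftrightarrow> z = \<Phi> \<tau> z'"
    if "\<tau> \<in> \<Gamma>" "z \<in> carrier G" "z' \<in> carrier G" for z z' \<tau>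
    using q_eq[OF automorphism_id that] cocycle_id[OF \<Phi> that(2)] by (simp add: f_def)
  have "inj_on f (carrier G)"
    using f_eq[OF automorphism_id] cocycle_id[OF \<Phi>] by (auto simp: inj_on_def f_def)
  moreover have "f (\<Phi> \<sigma> (map \<sigma> x)) = map \<sigma> (f x)" if \<sigma>: "\<sigma> \<in> \<Gamma>" and x: "x \<in> carrier G" for \<sigma> x
  proof -
    have "definable_map M A (tuples (k + n)) q"
      using q_ran q_def by (intro definable_mapI[OF subset_refl])
    then have "q (map \<sigma> (a @ x)) = map \<sigma> (q (a @ x))"
      by (rule definable_map_automorphism(2)[OF _ \<sigma>]) (simp add: k_def len[OF x])
    moreover have "f (\<Phi> \<sigma> (map \<sigma> x)) = q (map \<sigma> a @ map \<sigma> x)"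
      using f_eq[OF \<sigma> definable_isos_apply(1)[OF \<Phi>_iso[OF \<sigma>] aut[OF \<sigma> x]] aut[OF \<sigma> x]] by simp
    ultimately show ?thesis
      by (simp add: f_def)
  qed
  moreover have "definable_map M UNIV (carrier G) f"
  proof (rule definable_mapI)
    show "carrier G \<subseteq> tuples n"
      by (rule definable_set_subset[OF n])
    have f_len: "length (f x) = m" if "x \<in> carrier G" for x
      using subsetD[OF q_ran, OF imageI, of "a @ x"] len[OF that] by (simp add: f_def k_def)
    then show "f ` carrier G \<subseteq> tuples m"
      by auto
    let ?Z = "{x @ w | x w. length x = n \<and> length w = m \<and> x \<in> carrier G \<and>
      a @ x @ w \<in> graph_on (tuples (k + n)) q}"
    have "definable_set M UNIV (n + m) ?Z"
      by (intro definable_blocks2 definable_intros subset_UNIV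
          definable_pred_mem[OF definable_set_mono[OF n subset_UNIV]]
          definable_pred_mem[OF definable_set_mono[OF q_def subset_UNIV]])
    also have "a @ x @ w \<in> graph_on (tuples (k + n)) q \<longleftrightarrow> w = f x" if "length x = n" for x w
      using graph_on_append_iff[of "tuples (k + n)" "k + n" "a @ x" w q] that by (simp add: k_def f_def)
    then have "?Z = {x @ w | x w. length x = n \<and> length w = m \<and> x \<in> carrier G \<and> w = f x}"
      by (simp cong: conj_cong)
    also have "\<dots> = graph_on (carrier G) f"
      unfolding graph_on_def using len f_len by (intro Collect_cong) auto
    finally show "definable_set M UNIV (n + m) (graph_on (carrier G) f)" .
  qed
  moreover have \<Phi>_PiE: "\<Phi> \<in> \<Gamma> \<rightarrow>\<^sub>E carrier (Aut_def M G)"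
    using \<Phi> unfolding mem_cocycles by blast
  ultimately obtain H where H: "H \<in> A_forms M A G" "f \<in> definable_isos M UNIV G H"
    using form_of_equivariant_injection[of f \<Phi>] by (metis PiE_mem)
  have "form_cocycle M A G f = \<Phi>"
    by (rule form_cocycle_eqI[OF H \<Phi>_PiE]) fact
  with H show thesis by (rule that)
qed

text \<open>
  As every definable cocycle comes from a form, cohomology is the pullback of \<open>A\<close>-isomorphism and
  inherits its being an equivalence relation.
\<close>

lemma equiv_cohomologous_rel:
  assumes "eliminates_imaginaries M"
  shows "equiv (definable_cocycles M A G) (cohomologous_rel M A G)"
proof (rule equivI)
  note form = definable_cocycle_form[OF assms]
  show sub: "cohomologous_rel M A G \<subseteq> definable_cocycles M A G \<times> definable_cocycles M A G"
    unfolding cohomologous_rel_def by blast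
  have refl: "refl_on (A_forms M A G) (A_iso_rel M A G)"
    and sym: "sym (A_iso_rel M A G)" and trans: "trans (A_iso_rel M A G)"
    using equiv_A_iso_rel by (auto simp: equiv_def)
  show "refl_on (definable_cocycles M A G) (cohomologous_rel M A G)"
  proof (rule refl_onI)
    fix \<Phi> assume "\<Phi> \<in> definable_cocycles M A G"
    then show "(\<Phi>, \<Phi>) \<in> cohomologous_rel M A G"
      using form[of \<Phi>] cohomologous_iff_A_iso refl by (metis refl_onD)
  qed
  show "sym (cohomologous_rel M A G)"
  proof (rule symI)
    fix \<Phi> \<Psi> assume rel: "(\<Phi>, \<Psi>) \<in> cohomologous_rel M A G"
    obtain H f where Hf: "H \<in> A_forms M A G" "f \<in> definable_isos M UNIV G H" "form_cocycle M A G f = \<Phi>"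
      using form[of \<Phi>] rel sub by blast
    obtain K g where Kg: "K \<in> A_forms M A G" "g \<in> definable_isos M UNIV G K" "form_cocycle M A G g = \<Psi>"
      using form[of \<Psi>] rel sub by blast
    show "(\<Psi>, \<Phi>) \<in> cohomologous_rel M A G"
      using rel cohomologous_iff_A_iso[OF Hf(1,2) Kg(1,2)] cohomologous_iff_A_iso[OF Kg(1,2) Hf(1,2)]
        symD[OF sym] Hf(3) Kg(3) by metis
  qed
  show "trans (cohomologous_rel M A G)"
  proof (rule transI)
    fix \<Phi> \<Psi> \<Theta>
    assume rel: "(\<Phi>, \<Psi>) \<in> cohomologous_rel M A G" "(\<Psi>, \<Theta>) \<in> cohomologous_rel M A G"
    obtain H f where Hf: "H \<in> A_forms M A G" "f \<in> definable_isos M UNIV G H" "form_cocycle M A G f = \<Phi>"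
      using form[of \<Phi>] rel sub by blast
    obtain K g where Kg: "K \<in> A_forms M A G" "g \<in> definable_isos M UNIV G K" "form_cocycle M A G g = \<Psi>"
      using form[of \<Psi>] rel sub by blast
    obtain L e where Le: "L \<in> A_forms M A G" "e \<in> definable_isos M UNIV G L" "form_cocycle M A G e = \<Theta>"
      using form[of \<Theta>] rel sub by blast
    show "(\<Phi>, \<Theta>) \<in> cohomologous_rel M A G"
      using rel cohomologous_iff_A_iso[OF Hf(1,2) Kg(1,2)] cohomologous_iff_A_iso[OF Kg(1,2) Le(1,2)]
        cohomologous_iff_A_iso[OF Hf(1,2) Le(1,2)] transD[OF trans] Hf(3) Kg(3) Le(3) by metis
  qed
qed

end

section \<open>The classification of forms\<close>

theorem proposition2p4:
  fixes M :: "('f, 'r, 'm) fo_structure" and A :: "'m set" and G :: "'m list monoid"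
  assumes "atomic_over M A"
    and "homogeneous_over M A"
    and "theory_eliminates_imaginaries M"
    and "definable_group M A G"
  shows "\<exists>F. pointed_iso F (Forms M A G) (H1 M A G) \<and>
    (\<forall>H \<in> A_forms M A G. \<forall>f \<in> definable_isos M UNIV G H.
       F (A_iso_rel M A G `` {H}) = cohomologous_rel M A G `` {form_cocycle M A G f})"
proof -
  interpret atomic_homogeneous_group M A G
    by (rule atomic_homogeneous_group.intro) (rule assms)+
  have EI: "eliminates_imaginaries M"
    using assms(3) by (rule eliminates_imaginaries_self)
  let ?iso = "A_iso_rel M A G" and ?coh = "cohomologous_rel M A G"
  let ?forms = "A_forms M A G" and ?coc = "definable_cocycles M A G"
  note equiv_iso = equiv_A_iso_rel and equiv_coh = equiv_cohomologous_rel[OF EI]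
  have classes: "?coh `` {form_cocycle M A G f} = ?coh `` {form_cocycle M A G g}
      \<longleftrightarrow> ?iso `` {H} = ?iso `` {K}"
    if H: "H \<in> ?forms" "f \<in> definable_isos M UNIV G H" and K: "K \<in> ?forms" "g \<in> definable_isos M UNIV G K"
    for H K f g
    using eq_equiv_class_iff[OF equiv_coh form_cocycle_definable[OF H] form_cocycle_definable[OF K]]
      eq_equiv_class_iff[OF equiv_iso K(1) H(1)] cohomologous_iff_A_iso[OF H K] by blast
  have isos: "\<exists>f. f \<in> definable_isos M UNIV G H" if "H \<in> ?forms" for H
    using that unfolding A_forms_def by blast
  \<comment> \<open>The value on a class is that at any representative and any isomorphism to it, by \<open>classes\<close>.\<close>
  define F where "F C = (SOME D. \<exists>H \<in> ?forms. \<exists>f \<in> definable_isos M UNIV G H.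
    C = ?iso `` {H} \<and> D = ?coh `` {form_cocycle M A G f})" for C
  have F: "F (?iso `` {H}) = ?coh `` {form_cocycle M A G f}"
    if H: "H \<in> ?forms" and f: "f \<in> definable_isos M UNIV G H" for H f
  proof -
    have "\<exists>K \<in> ?forms. \<exists>g \<in> definable_isos M UNIV G K.
        ?iso `` {H} = ?iso `` {K} \<and> F (?iso `` {H}) = ?coh `` {form_cocycle M A G g}"
      unfolding F_def by (rule someI_ex) (use H f in blast)
    then show ?thesis
      using classes[OF _ _ H f] by metis
  qed
  have "bij_betw F (?forms // ?iso) (?coc // ?coh)"
    unfolding bij_betw_def
  proof
    show "inj_on F (?forms // ?iso)"
    proof (rule inj_onI)
      fix C D assume "C \<in> ?forms // ?iso" "D \<in> ?forms // ?iso" and eq: "F C = F D"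
      then obtain H K where H: "H \<in> ?forms" "C = ?iso `` {H}" and K: "K \<in> ?forms" "D = ?iso `` {K}"
        by (auto simp: quotient_def)
      obtain f g where f: "f \<in> definable_isos M UNIV G H" and g: "g \<in> definable_isos M UNIV G K"
        using isos H(1) K(1) by blast
      show "C = D"
        using eq F[OF H(1) f] F[OF K(1) g] classes[OF H(1) f K(1) g] H(2) K(2) by simp
    qed
    show "F ` (?forms // ?iso) = ?coc // ?coh"
    proof (intro equalityI subsetI)
      fix D assume "D \<in> F ` (?forms // ?iso)"
      then obtain H where H: "H \<in> ?forms" "D = F (?iso `` {H})"
        by (auto simp: quotient_def)
      obtain f where f: "f \<in> definable_isos M UNIV G H"
        using isos H(1) by blast
      show "D \<in> ?coc // ?coh"
        using quotientI[OF form_cocycle_definable[OF H(1) f]] F[OF H(1) f] H(2) by simp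
    next
      fix D assume "D \<in> ?coc // ?coh"
      then obtain \<Phi> where \<Phi>: "\<Phi> \<in> ?coc" "D = ?coh `` {\<Phi>}"
        by (rule quotientE)
      obtain H f where H: "H \<in> ?forms" "f \<in> definable_isos M UNIV G H" "form_cocycle M A G f = \<Phi>"
        using \<Phi>(1) by (rule definable_cocycle_form[OF EI])
      then have "D = F (?iso `` {H})"
        using F[OF H(1,2)] \<Phi>(2) by simp
      then show "D \<in> F ` (?forms // ?iso)"
        using quotientI[OF H(1)] by blast
    qed
  qed
  moreover have "F (?iso `` {G}) = ?coh `` {trivial_cocycle M A G}"
    using F[OF G_in_A_forms id_in_definable_isos] by (simp add: form_cocycle_id)
  moreover have "trivial_cocycle M A G \<in> ?coc"
    using form_cocycle_definable[OF G_in_A_forms id_in_definable_isos] by (simp add: form_cocycle_id)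
  ultimately have "pointed_iso F (Forms M A G) (H1 M A G)"
    using quotientI[OF G_in_A_forms] quotientI[of "trivial_cocycle M A G"]
    by (simp add: pointed_iso_def Forms_def H1_def)
  with F show ?thesis by blast
qed

end
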